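(* Each of the logics $\mathbf{ICK}$, $\mathbf{ICKT}$, $\mathbf{ICKS4}$, $\mathbf{ICKS5}$ has the finite model property: every formula not belonging to the logic is false at some world of some finite epistemic model based on a frame of the corresponding class. Consequently, the validity problem of each of these logics (given a formula $\varphi$, decide whether $\varphi$ belongs to the logic) is decidable.
   Context: Formulae over a finite non-empty set $\mathsf{A}$ of agents and atoms $\mathrm{Prop}$: $\varphi ::= \bot \mid p \mid \varphi\wedge\varphi\mid\varphi\vee\varphi\mid\varphi\to\varphi\mid K_a\varphi\mid C\varphi$. An epistemic frame $(\mathcal{W},\leq,\{R_a\}_{a\in\mathsf{A}})$ has $\mathcal{W}\neq\emptyset$, $\leq$ a partial order, $R_a\subseteq\mathcal{W}^2$ with triangle confluence ($w\leq v$ and $vR_au$ imply $wR_au$); it is reflexive/S4/S5 if every $R_a$ is reflexive / reflexive and transitive / an equivalence relation; finite if $\mathcal{W}$ is finite. An epistemic model adds a valuation $\mathcal{V}:\mathcal{W}\to\mathcal{P}(\mathrm{Prop})$ monotone in $\leq$; truth: $w\not\models\bot$, $w\models p$ iff $p\in\mathcal{V}(w)$, $\wedge,\vee$ as usual, $w\models\varphi\to\psi$ iff for all $v\geq w$, $v\models\varphi$ implies $v\models\psi$, $w\models K_a\varphi$ iff all $R_a$-successors satisfy $\varphi$, $w\models C\varphi$ iff all $R^*$-successors satisfy $\varphi$ ($R^*$ the reflexive–transitive closure of $\bigcup_aR_a$). $\mathbf{ICK}$, $\mathbf{ICKT}$, $\mathbf{ICKS4}$, $\mathbf{ICKS5}$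 are the sets of formulae valid (true at every world of every model) over all epistemic, reflexive, S4, S5 frames respectively. *)

theory Defs
  imports Main "HOL-Library.Nat_Bijection"
begin

section \<open>Formulae\<close>

datatype ('a, 'p) fm =
    Bot
  | Atom 'p
  | And "('a, 'p) fm" "('a, 'p) fm"
  | Or "('a, 'p) fm" "('a, 'p) fm"
  | Imp "('a, 'p) fm" "('a, 'p) fm"
  | Know 'a "('a, 'p) fm"
  | Common "('a, 'p) fm"


section \<open>Epistemic frames and models\<close>

record ('a, 'w) frame =
  worlds :: "'w set"
  leq :: "('w \<times> 'w) set"
  acc :: "'a \<Rightarrow> ('w \<times> 'w) set"

definition epistemic_frame :: "('a, 'w) frame \<Rightarrow> bool" where
  "epistemic_frame F \<longleftrightarrow>
     worlds F \<noteq> {} \<and>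
     partial_order_on (worlds F) (leq F) \<and>
     (\<forall>a. acc F a \<subseteq> worlds F \<times> worlds F) \<and>
     (\<forall>a w v u. (w, v) \<in> leq F \<longrightarrow> (v, u) \<in> acc F a \<longrightarrow> (w, u) \<in> acc F a)"

definition reflexive_frame :: "('a, 'w) frame \<Rightarrow> bool" where
  "reflexive_frame F \<longleftrightarrow>
     epistemic_frame F \<and> (\<forall>a. refl_on (worlds F) (acc F a))"

definition S4_frame :: "('a, 'w) frame \<Rightarrow> bool" where
  "S4_frame F \<longleftrightarrow>
     epistemic_frame F \<and> (\<forall>a. refl_on (worlds F) (acc F a) \<and> trans (acc F a))"

definition S5_frame :: "('a, 'w) frame \<Rightarrow> bool" where
  "S5_frame F \<longleftrightarrow>
     epistemic_frame F \<and> (\<forall>a. equiv (worlds F) (acc F a))"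

text \<open>A model is a frame together with a monotone valuation; only the values of the valuation
  on the worlds of the frame matter.\<close>

definition valuation_on :: "('a, 'w) frame \<Rightarrow> ('w \<Rightarrow> 'p set) \<Rightarrow> bool" where
  "valuation_on F V \<longleftrightarrow> (\<forall>w v. (w, v) \<in> leq F \<longrightarrow> V w \<subseteq> V v)"

primrec truth :: "('a, 'w) frame \<Rightarrow> ('w \<Rightarrow> 'p set) \<Rightarrow> 'w \<Rightarrow> ('a, 'p) fm \<Rightarrow> bool" where
  "truth F V w Bot \<longleftrightarrow> False"
| "truth F V w (Atom p) \<longleftrightarrow> p \<in> V w"
| "truth F V w (And \<phi> \<psi>) \<longleftrightarrow> truth F V w \<phi> \<and> truth F V w \<psi>"
| "truth F V w (Or \<phi> \<psi>) \<longleftrightarrow> truth F V w \<phi> \<or> truth F V w \<psi>"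
| "truth F V w (Imp \<phi> \<psi>) \<longleftrightarrow> (\<forall>v. (w, v) \<in> leq F \<longrightarrow> truth F V v \<phi> \<longrightarrow> truth F V v \<psi>)"
| "truth F V w (Know a \<phi>) \<longleftrightarrow> (\<forall>v. (w, v) \<in> acc F a \<longrightarrow> truth F V v \<phi>)"
| "truth F V w (Common \<phi>) \<longleftrightarrow> (\<forall>v. (w, v) \<in> (\<Union>a. acc F a)\<^sup>* \<longrightarrow> truth F V v \<phi>)"


section \<open>The logics\<close>

text \<open>HOL cannot quantify over the type of worlds inside a formula, so validity over a class of
  frames is relative to a type \<open>'w\<close> from which the worlds are drawn. The set of worlds itself is
  an arbitrary nonempty subset of \<open>'w\<close>.\<close>

definition valid_formulae :: "(('a, 'w) frame \<Rightarrow> bool) \<Rightarrow> ('a, 'p) fm set" where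
  "valid_formulae cls =
     {\<phi>. \<forall>F V. cls F \<longrightarrow> valuation_on F V \<longrightarrow> (\<forall>w \<in> worlds F. truth F V w \<phi>)}"

definition ICK :: "'w itself \<Rightarrow> ('a, 'p) fm set" where
  "ICK _ = valid_formulae (epistemic_frame :: ('a, 'w) frame \<Rightarrow> bool)"

definition ICKT :: "'w itself \<Rightarrow> ('a, 'p) fm set" where
  "ICKT _ = valid_formulae (reflexive_frame :: ('a, 'w) frame \<Rightarrow> bool)"

definition ICKS4 :: "'w itself \<Rightarrow> ('a, 'p) fm set" where
  "ICKS4 _ = valid_formulae (S4_frame :: ('a, 'w) frame \<Rightarrow> bool)"

definition ICKS5 :: "'w itself \<Rightarrow> ('a, 'p) fm set" where
  "ICKS5 _ = valid_formulae (S5_frame :: ('a, 'w) frame \<Rightarrow> bool)"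

text \<open>The class \<open>cls\<close> is used below at \<open>'v = nat\<close>: every finite frame is isomorphic to one whose
  worlds are natural numbers.\<close>

definition finite_model_property ::
    "('a, 'p) fm set \<Rightarrow> (('a, 'v) frame \<Rightarrow> bool) \<Rightarrow> bool" where
  "finite_model_property L cls \<longleftrightarrow>
     (\<forall>\<phi>. \<phi> \<notin> L \<longrightarrow>
       (\<exists>F V. cls F \<and> finite (worlds F) \<and> valuation_on F V \<and>
          (\<exists>w \<in> worlds F. \<not> truth F V w \<phi>)))"


section \<open>Decidability\<close>

text \<open>The total recursive functions, with minimization restricted to regular functions.
  In \<open>recursive n f\<close>, only the values of \<open>f\<close> on lists of length \<open>n\<close> are meaningful.\<close>

inductive recursive :: "nat \<Rightarrow> (nat list \<Rightarrow> nat) \<Rightarrow> bool" where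
  zero: "recursive n (\<lambda>xs. 0)"
| succ: "recursive 1 (\<lambda>xs. Suc (xs ! 0))"
| proj: "i < n \<Longrightarrow> recursive n (\<lambda>xs. xs ! i)"
| comp: "recursive (length fs) g \<Longrightarrow> (\<And>f. f \<in> set fs \<Longrightarrow> recursive n f) \<Longrightarrow>
    recursive n (\<lambda>xs. g (map (\<lambda>f. f xs) fs))"
| prim_rec: "recursive n g \<Longrightarrow> recursive (Suc (Suc n)) h \<Longrightarrow>
    recursive (Suc n) (\<lambda>xs. rec_nat (g (tl xs)) (\<lambda>k r. h (k # r # tl xs)) (hd xs))"
| minimize: "recursive (Suc n) f \<Longrightarrow> (\<And>xs. length xs = n \<Longrightarrow> \<exists>k. f (k # xs) = 0) \<Longrightarrow>
    recursive n (\<lambda>xs. LEAST k. f (k # xs) = 0)"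

text \<open>The problem ``given \<open>x\<close>, decide whether \<open>x \<in> L\<close>'', where inputs are presented by their
  codes; nothing is required of the algorithm on numbers that are not codes.\<close>

definition decidable :: "('x \<Rightarrow> nat) \<Rightarrow> 'x set \<Rightarrow> bool" where
  "decidable code L \<longleftrightarrow>
     (\<exists>f. recursive 1 f \<and> (\<forall>x. f [code x] = (if x \<in> L then 1 else 0)))"

text \<open>Goedel numbering of formulae, relative to numberings \<open>ea\<close> of the agents and \<open>ep\<close> of the
  atoms; \<open>prod_encode\<close> is the Cantor pairing function.\<close>

primrec fm_code :: "('a \<Rightarrow> nat) \<Rightarrow> ('p \<Rightarrow> nat) \<Rightarrow> ('a, 'p) fm \<Rightarrow> nat" where
  "fm_code ea ep Bot = prod_encode (0, 0)"
| "fm_code ea ep (Atom p) = prod_encode (1, ep p)"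
| "fm_code ea ep (And \<phi> \<psi>) = prod_encode (2, prod_encode (fm_code ea ep \<phi>, fm_code ea ep \<psi>))"
| "fm_code ea ep (Or \<phi> \<psi>) = prod_encode (3, prod_encode (fm_code ea ep \<phi>, fm_code ea ep \<psi>))"
| "fm_code ea ep (Imp \<phi> \<psi>) = prod_encode (4, prod_encode (fm_code ea ep \<phi>, fm_code ea ep \<psi>))"
| "fm_code ea ep (Know a \<phi>) = prod_encode (5, prod_encode (ea a, fm_code ea ep \<phi>))"
| "fm_code ea ep (Common \<phi>) = prod_encode (6, fm_code ea ep \<phi>)"

end

(* A countermodel M of a formula is filtrated through the set S of its subformulae: worlds with the
   same S-theory are identified, theories are ordered by inclusion (in S5 also by agreement on the
   modal formulae), and T' is accessible from T if the K- and C-formulae in T force what they should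
   at T'. Having kept C-formulae along accessibility makes the truth lemma for C go through. The
   result depends only on a finite set of finite sets of formulae, and whether such a set is a
   countermodel is a condition with bounded quantifiers on its code, also for C, because
   reachability can be expressed by quantifying over accessibility-closed sets of theories. Since
   the size of the filtration is bounded, the search for it is primitive recursive. *)

theory Submission
  imports Defs
begin

section \<open>Filtration\<close>

text \<open>Triangle confluence is the obstacle: the filtrated order and the filtrated accessibility
  relations have to fit together. Outside S5 accessibility constrains the target only through modal
  formulae present at the source; a smaller source imposes fewer constraints, so ordering by
  inclusion yields confluence at once. The two-way agreement demanded in S5 breaks this argument.
  The numberings \<open>ea\<close> and \<open>ep\<close> are arbitrary injections and may be
  noncomputable. The search tolerates this: the finitely many values \<open>ea a\<close> enter as
  constants, and no condition on a set of types inspects atoms. Nor is the set of subformulae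
  computed from the input: it is guessed, as any set of numbers that contains the input and meets
  the closure demands of \<open>type_model\<close>. Numbers in it that code no formula do no harm,
  since the truth lemma speaks only of labels of formulae.\<close>

datatype system = SysK | SysT | SysS4 | SysS5

fun frame_class :: "system \<Rightarrow> ('a, 'w) frame \<Rightarrow> bool" where
  "frame_class SysK = epistemic_frame"
| "frame_class SysT = reflexive_frame"
| "frame_class SysS4 = S4_frame"
| "frame_class SysS5 = S5_frame"

lemma frame_class_epistemic: "frame_class m F \<Longrightarrow> epistemic_frame F"
  by (cases m) (auto simp: reflexive_frame_def S4_frame_def S5_frame_def)

lemma frame_class_refl: "frame_class m F \<Longrightarrow> m \<noteq> SysK \<Longrightarrow> w \<in> worlds F \<Longrightarrow> (w, w) \<in> acc F a"
  by (cases m) (auto simp: reflexive_frame_def S4_frame_def S5_frame_def equiv_def refl_on_def)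

lemma epistemic_frame_leq:
  assumes "epistemic_frame F"
  shows "(w, v) \<in> leq F \<Longrightarrow> w \<in> worlds F \<and> v \<in> worlds F"
    and "w \<in> worlds F \<Longrightarrow> (w, w) \<in> leq F"
    and "(w, v) \<in> leq F \<Longrightarrow> (v, u) \<in> leq F \<Longrightarrow> (w, u) \<in> leq F"
  using assms
  unfolding epistemic_frame_def partial_order_on_def preorder_on_def refl_on_def trans_def by blast+

text \<open>Triangle confluence serves \<open>Know\<close> directly. For \<open>Common\<close> it
  replaces the first edge of a path from \<open>v\<close> by an edge from \<open>w\<close>; only the
  empty path needs the induction hypothesis.\<close>

lemma truth_mono:
  assumes F: "epistemic_frame F" and V: "valuation_on F V"
  shows "(w, v) \<in> leq F \<Longrightarrow> truth F V w \<phi> \<Longrightarrow> truth F V v \<phi>"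
proof (induction \<phi> arbitrary: w v)
  case (Atom p)
  then show ?case using V by (auto simp: valuation_on_def)
next
  case (Imp \<phi> \<psi>)
  then show ?case using epistemic_frame_leq(3)[OF F] by auto
next
  case (Know a \<phi>)
  then show ?case using F by (auto simp: epistemic_frame_def)
next
  case (Common \<phi>)
  have tri: "(w, u) \<in> (\<Union>a. acc F a)" if "(v, u) \<in> (\<Union>a. acc F a)" for u
    using F that Common.prems(1) unfolding epistemic_frame_def by blast
  have "truth F V u \<phi>" if "(v, u) \<in> (\<Union>a. acc F a)\<^sup>*" for u
    using that
  proof (cases rule: converse_rtranclE)
    case base
    have "truth F V w \<phi>" using Common.prems(2) by simp
    then show ?thesis using Common.IH[OF Common.prems(1)] base by simp
  next
    case (step x)
    then have "(w, u) \<in> (\<Union>a. acc F a)\<^sup>*" using tri by (meson converse_rtrancl_into_rtrancl)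
    then show ?thesis using Common.prems(2) by simp
  qed
  then show ?case by simp
qed auto

primrec subformulae :: "('a, 'p) fm \<Rightarrow> ('a, 'p) fm set" where
  "subformulae Bot = {Bot}"
| "subformulae (Atom p) = {Atom p}"
| "subformulae (And \<phi> \<psi>) = insert (And \<phi> \<psi>) (subformulae \<phi> \<union> subformulae \<psi>)"
| "subformulae (Or \<phi> \<psi>) = insert (Or \<phi> \<psi>) (subformulae \<phi> \<union> subformulae \<psi>)"
| "subformulae (Imp \<phi> \<psi>) = insert (Imp \<phi> \<psi>) (subformulae \<phi> \<union> subformulae \<psi>)"
| "subformulae (Know a \<phi>) = insert (Know a \<phi>) (subformulae \<phi>)"
| "subformulae (Common \<phi>) = insert (Common \<phi>) (subformulae \<phi>)"

lemma finite_subformulae: "finite (subformulae \<phi>)"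
  by (induction \<phi>) auto

lemma subformulae_self: "\<phi> \<in> subformulae \<phi>"
  by (cases \<phi>) auto

lemma subformulae_trans: "\<psi> \<in> subformulae \<phi> \<Longrightarrow> subformulae \<psi> \<subseteq> subformulae \<phi>"
  by (induction \<phi>) auto

text \<open>Formulae are represented by labels: themselves for the finite model property, their Goedel
  numbers for decidability.\<close>

locale formula_labels =
  fixes lab :: "('a, 'p) fm \<Rightarrow> 'c"
    and land lor limp :: "'c \<Rightarrow> 'c \<Rightarrow> 'c"
    and lknow :: "'a \<Rightarrow> 'c \<Rightarrow> 'c"
    and lcommon :: "'c \<Rightarrow> 'c"
  assumes inj_lab: "inj lab"
    and lab_and: "lab \<phi> = land x y \<longleftrightarrow> (\<exists>\<psi> \<chi>. \<phi> = And \<psi> \<chi> \<and> x = lab \<psi> \<and> y = lab \<chi>)"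
    and lab_or: "lab \<phi> = lor x y \<longleftrightarrow> (\<exists>\<psi> \<chi>. \<phi> = Or \<psi> \<chi> \<and> x = lab \<psi> \<and> y = lab \<chi>)"
    and lab_imp: "lab \<phi> = limp x y \<longleftrightarrow> (\<exists>\<psi> \<chi>. \<phi> = Imp \<psi> \<chi> \<and> x = lab \<psi> \<and> y = lab \<chi>)"
    and lab_know: "lab \<phi> = lknow a x \<longleftrightarrow> (\<exists>\<psi>. \<phi> = Know a \<psi> \<and> x = lab \<psi>)"
    and lab_common: "lab \<phi> = lcommon x \<longleftrightarrow> (\<exists>\<psi>. \<phi> = Common \<psi> \<and> x = lab \<psi>)"
begin

text \<open>Transitivity (S4) and equivalence (S5) hold by the form of the condition. There
  \<open>Know\<close> formulae are passed on whole, and their bodies follow from reflexivity at the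
  target. In the remaining systems only bodies are passed on, so reflexivity for \<open>SysT\<close>
  must be demanded separately, in \<open>type_model\<close>.\<close>

fun type_acc :: "system \<Rightarrow> 'a \<Rightarrow> 'c set \<Rightarrow> 'c set \<Rightarrow> bool" where
  "type_acc SysS4 a S T \<longleftrightarrow>
     (\<forall>x. lknow a x \<in> S \<longrightarrow> lknow a x \<in> T) \<and> (\<forall>x. lcommon x \<in> S \<longrightarrow> lcommon x \<in> T)"
| "type_acc SysS5 a S T \<longleftrightarrow>
     (\<forall>x. lknow a x \<in> S \<longleftrightarrow> lknow a x \<in> T) \<and> (\<forall>x. lcommon x \<in> S \<longleftrightarrow> lcommon x \<in> T)"
| "type_acc _ a S T \<longleftrightarrow>
     (\<forall>x. lknow a x \<in> S \<longrightarrow> x \<in> T) \<and> (\<forall>x. lcommon x \<in> S \<longrightarrow> lcommon x \<in> T)"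

text \<open>In an S5 frame \<open>leq\<close> is contained in every \<open>acc a\<close> by triangle confluence and reflexivity,
  so the filtrated order may be, and for triangle confluence must be, cut down accordingly.\<close>

definition type_leq :: "system \<Rightarrow> 'c set \<Rightarrow> 'c set \<Rightarrow> bool" where
  "type_leq m S T \<longleftrightarrow> S \<subseteq> T \<and> (m = SysS5 \<longrightarrow> (\<forall>a. type_acc m a S T))"

text \<open>The last clause expresses ``\<open>x\<close> fails somewhere reachable from \<open>T\<close> if \<open>C x \<notin> T\<close>'' by
  quantification over accessibility-closed sets, which avoids paths.\<close>

definition common_condition :: "system \<Rightarrow> 'c set set \<Rightarrow> 'c \<Rightarrow> bool" where
  "common_condition m H x \<longleftrightarrow>
     (\<forall>T\<in>H. lcommon x \<in> T \<longrightarrow> x \<in> T) \<and>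
     (\<forall>X\<subseteq>H. (\<forall>T\<in>X. x \<in> T) \<longrightarrow> (\<forall>T\<in>X. \<forall>S\<in>H. (\<exists>a. type_acc m a T S) \<longrightarrow> S \<in> X) \<longrightarrow>
        (\<forall>T\<in>X. lcommon x \<in> T))"

text \<open>These are the clauses of the truth lemma with truth replaced by membership. They mention
  labels only, so on numbers they can be tested without recognising codes of formulae; closing
  \<Sigma> under components is what lets the induction on formulae run.\<close>

definition type_model :: "system \<Rightarrow> 'c set \<Rightarrow> 'c set set \<Rightarrow> bool" where
  "type_model m \<Sigma> H \<longleftrightarrow>
     (\<forall>T\<in>H. lab Bot \<notin> T) \<and>
     (\<forall>x y. land x y \<in> \<Sigma> \<longrightarrow> x \<in> \<Sigma> \<and> y \<in> \<Sigma> \<and> (\<forall>T\<in>H. land x y \<in> T \<longleftrightarrow> x \<in> T \<and> y \<in> T)) \<and>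
     (\<forall>x y. lor x y \<in> \<Sigma> \<longrightarrow> x \<in> \<Sigma> \<and> y \<in> \<Sigma> \<and> (\<forall>T\<in>H. lor x y \<in> T \<longleftrightarrow> x \<in> T \<or> y \<in> T)) \<and>
     (\<forall>x y. limp x y \<in> \<Sigma> \<longrightarrow> x \<in> \<Sigma> \<and> y \<in> \<Sigma> \<and>
        (\<forall>T\<in>H. limp x y \<in> T \<longleftrightarrow> (\<forall>S\<in>H. type_leq m T S \<longrightarrow> x \<in> S \<longrightarrow> y \<in> S))) \<and>
     (\<forall>a x. lknow a x \<in> \<Sigma> \<longrightarrow> x \<in> \<Sigma> \<and>
        (\<forall>T\<in>H. lknow a x \<in> T \<longleftrightarrow> (\<forall>S\<in>H. type_acc m a T S \<longrightarrow> x \<in> S))) \<and>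
     (\<forall>x. lcommon x \<in> \<Sigma> \<longrightarrow> x \<in> \<Sigma> \<and> common_condition m H x) \<and>
     (m = SysT \<longrightarrow> (\<forall>T\<in>H. \<forall>a. type_acc m a T T))"

section \<open>From a set of types to a countermodel\<close>

lemma lab_simps:
  "lab (And \<phi> \<psi>) = land (lab \<phi>) (lab \<psi>)"
  "lab (Or \<phi> \<psi>) = lor (lab \<phi>) (lab \<psi>)"
  "lab (Imp \<phi> \<psi>) = limp (lab \<phi>) (lab \<psi>)"
  "lab (Know a \<phi>) = lknow a (lab \<phi>)"
  "lab (Common \<phi>) = lcommon (lab \<phi>)"
  using lab_and lab_or lab_imp lab_know lab_common by blast+

text \<open>Outside S5, \<open>type_acc\<close> is antitone in its source. In S5,
  \<open>type_leq\<close> includes \<open>type_acc\<close>, which is transitive.\<close>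

lemma type_leq_triangle:
  "type_leq m S T \<Longrightarrow> type_acc m a T U \<Longrightarrow> type_acc m a S U"
  unfolding type_leq_def by (cases m) auto

lemma type_leq_trans: "type_leq m S T \<Longrightarrow> type_leq m T U \<Longrightarrow> type_leq m S U"
  unfolding type_leq_def by (cases m) auto

lemma type_acc_common: "type_acc m a S T \<Longrightarrow> lcommon x \<in> S \<Longrightarrow> lcommon x \<in> T"
  by (cases m) auto

text \<open>Worlds come from an arbitrary type and receive their types through \<open>th\<close>, so
  one set of types gives countermodels both over \<open>nat\<close> and over the type
  \<open>'w\<close> of the logic.\<close>

definition type_frame :: "system \<Rightarrow> ('w \<Rightarrow> 'c set) \<Rightarrow> 'w set \<Rightarrow> ('a, 'w) frame" where
  "type_frame m th W =
     \<lparr>worlds = W,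
      leq = {(w, v). w \<in> W \<and> v \<in> W \<and> type_leq m (th w) (th v)},
      acc = (\<lambda>a. {(w, v). w \<in> W \<and> v \<in> W \<and> type_acc m a (th w) (th v)})\<rparr>"

text \<open>Injectivity of \<open>th\<close> gives antisymmetry: worlds whose types include each
  other coincide.\<close>

lemma type_frame_class:
  assumes "inj_on th W" "W \<noteq> {}" "m = SysT \<longrightarrow> (\<forall>w\<in>W. \<forall>a. type_acc m a (th w) (th w))"
  shows "frame_class m (type_frame m th W)"
proof -
  have "epistemic_frame (type_frame m th W)"
    unfolding epistemic_frame_def type_frame_def partial_order_on_def preorder_on_def
  proof (auto intro: type_leq_triangle simp: assms(2))
    show "refl_on W {(w, v). w \<in> W \<and> v \<in> W \<and> type_leq m (th w) (th v)}"
      by (auto simp: refl_on_def type_leq_def)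
    show "trans {(w, v). w \<in> W \<and> v \<in> W \<and> type_leq m (th w) (th v)}"
      by (auto simp: trans_def intro: type_leq_trans)
    show "antisym {(w, v). w \<in> W \<and> v \<in> W \<and> type_leq m (th w) (th v)}"
      using assms(1) by (auto simp: antisym_def type_leq_def inj_on_def)
  qed
  then show ?thesis using assms(3)
    by (cases m) (auto simp: reflexive_frame_def S4_frame_def S5_frame_def type_frame_def
        equiv_def refl_on_def trans_def sym_def)
qed

lemma type_modelD:
  assumes "type_model m \<Sigma> H"
  shows type_model_bot: "T \<in> H \<Longrightarrow> lab Bot \<notin> T"
    and type_model_and: "land x y \<in> \<Sigma> \<Longrightarrow>
      x \<in> \<Sigma> \<and> y \<in> \<Sigma> \<and> (\<forall>T\<in>H. land x y \<in> T \<longleftrightarrow> x \<in> T \<and> y \<in> T)"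
    and type_model_or: "lor x y \<in> \<Sigma> \<Longrightarrow>
      x \<in> \<Sigma> \<and> y \<in> \<Sigma> \<and> (\<forall>T\<in>H. lor x y \<in> T \<longleftrightarrow> x \<in> T \<or> y \<in> T)"
    and type_model_imp: "limp x y \<in> \<Sigma> \<Longrightarrow> x \<in> \<Sigma> \<and> y \<in> \<Sigma> \<and>
      (\<forall>T\<in>H. limp x y \<in> T \<longleftrightarrow> (\<forall>S\<in>H. type_leq m T S \<longrightarrow> x \<in> S \<longrightarrow> y \<in> S))"
    and type_model_know: "lknow a x \<in> \<Sigma> \<Longrightarrow> x \<in> \<Sigma> \<and>
      (\<forall>T\<in>H. lknow a x \<in> T \<longleftrightarrow> (\<forall>S\<in>H. type_acc m a T S \<longrightarrow> x \<in> S))"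
    and type_model_common: "lcommon x \<in> \<Sigma> \<Longrightarrow> x \<in> \<Sigma> \<and> common_condition m H x"
    and type_model_refl: "m = SysT \<longrightarrow> (\<forall>T\<in>H. \<forall>a. type_acc m a T T)"
proof -
  note q = assms[unfolded type_model_def]
  show "T \<in> H \<Longrightarrow> lab Bot \<notin> T"
    using q[THEN conjunct1] by blast
  show "land x y \<in> \<Sigma> \<Longrightarrow>
      x \<in> \<Sigma> \<and> y \<in> \<Sigma> \<and> (\<forall>T\<in>H. land x y \<in> T \<longleftrightarrow> x \<in> T \<and> y \<in> T)"
    using q[THEN conjunct2, THEN conjunct1] by blast
  show "lor x y \<in> \<Sigma> \<Longrightarrow>
      x \<in> \<Sigma> \<and> y \<in> \<Sigma> \<and> (\<forall>T\<in>H. lor x y \<in> T \<longleftrightarrow> x \<in> T \<or> y \<in> T)"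
    using q[THEN conjunct2, THEN conjunct2, THEN conjunct1] by blast
  show "limp x y \<in> \<Sigma> \<Longrightarrow> x \<in> \<Sigma> \<and> y \<in> \<Sigma> \<and>
      (\<forall>T\<in>H. limp x y \<in> T \<longleftrightarrow> (\<forall>S\<in>H. type_leq m T S \<longrightarrow> x \<in> S \<longrightarrow> y \<in> S))"
    using q[THEN conjunct2, THEN conjunct2, THEN conjunct2, THEN conjunct1] by blast
  show "lknow a x \<in> \<Sigma> \<Longrightarrow> x \<in> \<Sigma> \<and>
      (\<forall>T\<in>H. lknow a x \<in> T \<longleftrightarrow> (\<forall>S\<in>H. type_acc m a T S \<longrightarrow> x \<in> S))"
    using q[THEN conjunct2, THEN conjunct2, THEN conjunct2, THEN conjunct2, THEN conjunct1] by blast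
  show "lcommon x \<in> \<Sigma> \<Longrightarrow> x \<in> \<Sigma> \<and> common_condition m H x"
    using q[THEN conjunct2, THEN conjunct2, THEN conjunct2, THEN conjunct2, THEN conjunct2, THEN conjunct1] by blast
  show "m = SysT \<longrightarrow> (\<forall>T\<in>H. \<forall>a. type_acc m a T T)"
    using q[THEN conjunct2, THEN conjunct2, THEN conjunct2, THEN conjunct2, THEN conjunct2, THEN conjunct2] by blast
qed

lemma truth_type_frame:
  assumes q: "type_model m \<Sigma> (th ` W)"
  shows "lab \<phi> \<in> \<Sigma> \<Longrightarrow> w \<in> W \<Longrightarrow>
    truth (type_frame m th W) (\<lambda>w. {p. lab (Atom p) \<in> th w}) w \<phi> \<longleftrightarrow> lab \<phi> \<in> th w"
proof (induction \<phi> arbitrary: w)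
  case Bot
  then show ?case using type_model_bot[OF q] by simp
next
  case (And \<phi> \<psi>)
  then show ?case using type_model_and[OF q, of "lab \<phi>" "lab \<psi>"] by (simp add: lab_simps)
next
  case (Or \<phi> \<psi>)
  then show ?case using type_model_or[OF q, of "lab \<phi>" "lab \<psi>"] by (simp add: lab_simps)
next
  case (Imp \<phi> \<psi>)
  have "lab \<phi> \<in> \<Sigma>" "lab \<psi> \<in> \<Sigma>" and
    "limp (lab \<phi>) (lab \<psi>) \<in> th w \<longleftrightarrow>
      (\<forall>v\<in>W. type_leq m (th w) (th v) \<longrightarrow> lab \<phi> \<in> th v \<longrightarrow> lab \<psi> \<in> th v)"
    using Imp.prems type_model_imp[OF q, of "lab \<phi>" "lab \<psi>"] by (simp_all add: lab_simps)
  then show ?case using Imp.IH \<open>w \<in> W\<close> by (auto simp: lab_simps type_frame_def)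
next
  case (Know a \<phi>)
  have "lab \<phi> \<in> \<Sigma>" and
    "lknow a (lab \<phi>) \<in> th w \<longleftrightarrow> (\<forall>v\<in>W. type_acc m a (th w) (th v) \<longrightarrow> lab \<phi> \<in> th v)"
    using Know.prems type_model_know[OF q, of a "lab \<phi>"] by (simp_all add: lab_simps)
  then show ?case using Know.IH \<open>w \<in> W\<close> by (auto simp: lab_simps type_frame_def)
next
  case (Common \<phi>)
  let ?F = "type_frame m th W"
  let ?V = "\<lambda>w. {p. lab (Atom p) \<in> th w}"
  let ?R = "(\<Union>a. acc ?F a)"
  have \<phi>: "lab \<phi> \<in> \<Sigma>" and c: "common_condition m (th ` W) (lab \<phi>)"
    using Common.prems type_model_common[OF q, of "lab \<phi>"] by (simp_all add: lab_simps)
  have RW: "v \<in> W" if "(w, v) \<in> ?R\<^sup>*" for v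
    using that \<open>w \<in> W\<close> by (induction) (auto simp: type_frame_def)
  have "lcommon (lab \<phi>) \<in> th w \<longleftrightarrow> (\<forall>v. (w, v) \<in> ?R\<^sup>* \<longrightarrow> lab \<phi> \<in> th v)"
  proof
    assume w: "lcommon (lab \<phi>) \<in> th w"
    \<comment> \<open>Membership of the \<open>Common\<close> label travels along every edge; at the
      end of the path the first clause of \<open>common_condition\<close> releases the body.\<close>
    have "lcommon (lab \<phi>) \<in> th v" if "(w, v) \<in> ?R\<^sup>*" for v
      using that w by induction (auto simp: type_frame_def dest: type_acc_common)
    then show "\<forall>v. (w, v) \<in> ?R\<^sup>* \<longrightarrow> lab \<phi> \<in> th v"
      using c RW by (auto simp: common_condition_def)
  next
    assume w: "\<forall>v. (w, v) \<in> ?R\<^sup>* \<longrightarrow> lab \<phi> \<in> th v"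
    \<comment> \<open>The types reached from \<open>w\<close> form an accessibility-closed set, to
      which the second clause of \<open>common_condition\<close> applies.\<close>
    define X where "X = th ` {v. (w, v) \<in> ?R\<^sup>*}"
    have "X \<subseteq> th ` W" using RW by (auto simp: X_def)
    moreover have "\<forall>T\<in>X. lab \<phi> \<in> T" using w by (auto simp: X_def)
    moreover have "\<forall>T\<in>X. \<forall>S\<in>th ` W. (\<exists>a. type_acc m a T S) \<longrightarrow> S \<in> X"
    proof (intro ballI impI)
      fix T S assume "T \<in> X" "S \<in> th ` W" "\<exists>a. type_acc m a T S"
      then obtain v u a where vu: "(w, v) \<in> ?R\<^sup>*" "T = th v" "S = th u" "u \<in> W"
        "type_acc m a (th v) (th u)" by (auto simp: X_def)
      have "(v, u) \<in> acc ?F a"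
        using RW[OF vu(1)] vu(4,5) by (simp add: type_frame_def)
      then have "(v, u) \<in> ?R" by blast
      with vu(1) have "(w, u) \<in> ?R\<^sup>*" by (rule rtrancl_into_rtrancl)
      then show "S \<in> X" using vu(3) unfolding X_def by blast
    qed
    ultimately have "\<forall>T\<in>X. lcommon (lab \<phi>) \<in> T"
      using c unfolding common_condition_def by blast
    then show "lcommon (lab \<phi>) \<in> th w" by (auto simp: X_def)
  qed
  moreover have "truth ?F ?V v \<phi> \<longleftrightarrow> lab \<phi> \<in> th v" if "(w, v) \<in> ?R\<^sup>*" for v
    using Common.IH[OF \<phi>] RW that by blast
  ultimately show ?case by (simp add: lab_simps)
qed simp

lemma type_model_countermodel:
  fixes W :: "'w set"
  assumes q: "type_model m \<Sigma> H" and H: "bij_betw th W H" and \<phi>: "lab \<phi> \<in> \<Sigma>"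
    and T: "T \<in> H" "lab \<phi> \<notin> T"
  shows "\<exists>F V. frame_class m F \<and> worlds F = W \<and> valuation_on F V \<and>
           (\<exists>w\<in>worlds F. \<not> truth F V w \<phi>)"
proof -
  let ?F = "type_frame m th W"
  let ?V = "\<lambda>w. {p. lab (Atom p) \<in> th w}"
  have H': "H = th ` W" and inj: "inj_on th W"
    using H by (auto simp: bij_betw_def)
  obtain w where w: "w \<in> W" "lab \<phi> \<notin> th w" using T H' by auto
  have "frame_class m ?F"
    using w inj type_model_refl[OF q[unfolded H']] by (intro type_frame_class) auto
  moreover have "worlds ?F = W" by (simp add: type_frame_def)
  moreover have "valuation_on ?F ?V"
    by (auto simp: valuation_on_def type_frame_def type_leq_def)
  moreover have "\<not> truth ?F ?V w \<phi>"
    using truth_type_frame[OF q[unfolded H'] \<phi>] w by simp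
  ultimately show ?thesis using w by metis
qed

section \<open>From a model to a set of types\<close>

definition world_type :: "('a, 'p) fm \<Rightarrow> ('a, 'w) frame \<Rightarrow> ('w \<Rightarrow> 'p set) \<Rightarrow> 'w \<Rightarrow> 'c set" where
  "world_type \<phi> F V w = lab ` {\<psi> \<in> subformulae \<phi>. truth F V w \<psi>}"

lemma mem_world_type: "lab \<psi> \<in> world_type \<phi> F V w \<longleftrightarrow> \<psi> \<in> subformulae \<phi> \<and> truth F V w \<psi>"
  using inj_lab by (auto simp: world_type_def inj_def)

lemma world_typeE:
  assumes "x \<in> world_type \<phi> F V w"
  obtains \<psi> where "x = lab \<psi>" "\<psi> \<in> subformulae \<phi>" "truth F V w \<psi>"
  using assms by (auto simp: world_type_def)

lemma lknow_world_type:
  "lknow a x \<in> world_type \<phi> F V w \<longleftrightarrow>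
    (\<exists>\<psi>. x = lab \<psi> \<and> Know a \<psi> \<in> subformulae \<phi> \<and> truth F V w (Know a \<psi>))"
proof
  assume "lknow a x \<in> world_type \<phi> F V w"
  then obtain \<chi> where "lab \<chi> = lknow a x" "\<chi> \<in> subformulae \<phi>" "truth F V w \<chi>"
    by (metis world_typeE)
  then show "\<exists>\<psi>. x = lab \<psi> \<and> Know a \<psi> \<in> subformulae \<phi> \<and> truth F V w (Know a \<psi>)"
    unfolding lab_know by blast
qed (auto simp: lab_simps(4)[symmetric] mem_world_type)

lemma lcommon_world_type:
  "lcommon x \<in> world_type \<phi> F V w \<longleftrightarrow>
    (\<exists>\<psi>. x = lab \<psi> \<and> Common \<psi> \<in> subformulae \<phi> \<and> truth F V w (Common \<psi>))"
proof
  assume "lcommon x \<in> world_type \<phi> F V w"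
  then obtain \<chi> where "lab \<chi> = lcommon x" "\<chi> \<in> subformulae \<phi>" "truth F V w \<chi>"
    by (metis world_typeE)
  then show "\<exists>\<psi>. x = lab \<psi> \<and> Common \<psi> \<in> subformulae \<phi> \<and> truth F V w (Common \<psi>)"
    unfolding lab_common by blast
qed (auto simp: lab_simps(5)[symmetric] mem_world_type)

text \<open>The filtrated relation extends the original one. Transitivity preserves
  \<open>Know\<close> in S4, and symmetry adds the converse in S5. \<open>Common\<close> survives in
  every system because an edge can be prefixed to a path.\<close>

lemma world_type_acc:
  assumes F: "frame_class m F" and R: "(w, v) \<in> acc F a"
  shows "type_acc m a (world_type \<phi> F V w) (world_type \<phi> F V v)"
proof -
  have sub: "\<psi> \<in> subformulae \<phi>" if "Know a \<psi> \<in> subformulae \<phi>" for \<psi>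
    using subformulae_trans[OF that] subformulae_self[of \<psi>] by auto
  have com: "truth F V v (Common \<psi>)" if "truth F V w (Common \<psi>)" for \<psi>
    using that R by (auto intro: converse_rtrancl_into_rtrancl)
  show ?thesis
  proof (cases m)
    case SysS4
    then have "trans (acc F a)" using F by (simp add: S4_frame_def)
    then have "truth F V v (Know a \<psi>)" if "truth F V w (Know a \<psi>)" for \<psi>
      using that R by (auto dest: transD)
    then show ?thesis unfolding SysS4 type_acc.simps lknow_world_type lcommon_world_type
      using com by blast
  next
    case SysS5
    then have "trans (acc F a)" and sym: "sym (acc F a)"
      using F by (simp_all add: S5_frame_def equiv_def)
    then have "truth F V v (Know a \<psi>) \<longleftrightarrow> truth F V w (Know a \<psi>)" for \<psi>
      using R by (auto dest: transD symD)
    moreover have "truth F V w (Common \<psi>)" if "truth F V v (Common \<psi>)" for \<psi>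
      using that R sym by (auto intro: converse_rtrancl_into_rtrancl dest: symD)
    ultimately show ?thesis unfolding SysS5 type_acc.simps lknow_world_type lcommon_world_type
      using com by blast
  next
    case SysK
    show ?thesis unfolding SysK type_acc.simps lknow_world_type lcommon_world_type
      using com sub R by (auto simp: mem_world_type)
  next
    case SysT
    show ?thesis unfolding SysT type_acc.simps lknow_world_type lcommon_world_type
      using com sub R by (auto simp: mem_world_type)
  qed
qed

lemma world_type_leq:
  assumes F: "frame_class m F" and V: "valuation_on F V" and R: "(w, v) \<in> leq F"
  shows "type_leq m (world_type \<phi> F V w) (world_type \<phi> F V v)"
proof -
  note E = frame_class_epistemic[OF F]
  have "world_type \<phi> F V w \<subseteq> world_type \<phi> F V v"
    using truth_mono[OF E V R] by (auto simp: world_type_def)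
  moreover have "type_acc m a (world_type \<phi> F V w) (world_type \<phi> F V v)" if "m = SysS5" for a
  proof (rule world_type_acc[OF F])
    have "(v, v) \<in> acc F a"
      using frame_class_refl[OF F] that epistemic_frame_leq(1)[OF E R] by auto
    then show "(w, v) \<in> acc F a" using E R by (auto simp: epistemic_frame_def)
  qed
  ultimately show ?thesis unfolding type_leq_def by simp
qed

text \<open>In the clauses for \<open>Imp\<close> and \<open>Know\<close>, one direction holds
  because filtrated relations extend the original ones, the other because a filtrated edge transfers
  enough formulae to force the conclusion at its target.\<close>

lemma type_model_world_types:
  assumes F: "frame_class m F" and V: "valuation_on F V"
  shows "type_model m (lab ` subformulae \<phi>) (world_type \<phi> F V ` worlds F)"
    (is "type_model m ?\<Sigma> (?t ` ?W)")
proof -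
  note E = frame_class_epistemic[OF F]
  have sub: "\<psi> \<in> subformulae \<phi>" if "\<chi> \<in> subformulae \<phi>" "\<psi> \<in> subformulae \<chi>" for \<psi> \<chi>
    using that subformulae_trans by blast
  have mem: "lab \<psi> \<in> ?\<Sigma> \<longleftrightarrow> \<psi> \<in> subformulae \<phi>" for \<psi>
    using inj_lab by (auto simp: inj_def)
  note [simp] = mem_world_type subformulae_self lab_simps[symmetric]
  show ?thesis
    unfolding type_model_def
  proof (intro conjI)
    show "\<forall>T\<in>?t ` ?W. lab Bot \<notin> T" by simp
    show "\<forall>x y. land x y \<in> ?\<Sigma> \<longrightarrow> x \<in> ?\<Sigma> \<and> y \<in> ?\<Sigma> \<and>
        (\<forall>T\<in>?t ` ?W. land x y \<in> T \<longleftrightarrow> x \<in> T \<and> y \<in> T)"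
    proof (intro allI impI)
      fix x y assume "land x y \<in> ?\<Sigma>"
      then obtain \<chi> where "lab \<chi> = land x y" "\<chi> \<in> subformulae \<phi>" by (metis imageE)
      then obtain \<psi>1 \<psi>2 where *: "x = lab \<psi>1" "y = lab \<psi>2" "And \<psi>1 \<psi>2 \<in> subformulae \<phi>"
        unfolding lab_and by blast
      then have "\<psi>1 \<in> subformulae \<phi>" "\<psi>2 \<in> subformulae \<phi>"
        using sub[OF *(3)] by auto
      then show "x \<in> ?\<Sigma> \<and> y \<in> ?\<Sigma> \<and> (\<forall>T\<in>?t ` ?W. land x y \<in> T \<longleftrightarrow> x \<in> T \<and> y \<in> T)"
        using * by auto
    qed
    show "\<forall>x y. lor x y \<in> ?\<Sigma> \<longrightarrow> x \<in> ?\<Sigma> \<and> y \<in> ?\<Sigma> \<and>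
        (\<forall>T\<in>?t ` ?W. lor x y \<in> T \<longleftrightarrow> x \<in> T \<or> y \<in> T)"
    proof (intro allI impI)
      fix x y assume "lor x y \<in> ?\<Sigma>"
      then obtain \<chi> where "lab \<chi> = lor x y" "\<chi> \<in> subformulae \<phi>" by (metis imageE)
      then obtain \<psi>1 \<psi>2 where *: "x = lab \<psi>1" "y = lab \<psi>2" "Or \<psi>1 \<psi>2 \<in> subformulae \<phi>"
        unfolding lab_or by blast
      then have "\<psi>1 \<in> subformulae \<phi>" "\<psi>2 \<in> subformulae \<phi>"
        using sub[OF *(3)] by auto
      then show "x \<in> ?\<Sigma> \<and> y \<in> ?\<Sigma> \<and> (\<forall>T\<in>?t ` ?W. lor x y \<in> T \<longleftrightarrow> x \<in> T \<or> y \<in> T)"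
        using * by auto
    qed
    show "\<forall>x y. limp x y \<in> ?\<Sigma> \<longrightarrow> x \<in> ?\<Sigma> \<and> y \<in> ?\<Sigma> \<and>
        (\<forall>T\<in>?t ` ?W. limp x y \<in> T \<longleftrightarrow> (\<forall>S\<in>?t ` ?W. type_leq m T S \<longrightarrow> x \<in> S \<longrightarrow> y \<in> S))"
    proof (intro allI impI)
      fix x y assume "limp x y \<in> ?\<Sigma>"
      then obtain \<chi> where "lab \<chi> = limp x y" "\<chi> \<in> subformulae \<phi>" by (metis imageE)
      then obtain \<psi>1 \<psi>2 where *: "x = lab \<psi>1" "y = lab \<psi>2" "Imp \<psi>1 \<psi>2 \<in> subformulae \<phi>"
        unfolding lab_imp by blast
      then have s: "\<psi>1 \<in> subformulae \<phi>" "\<psi>2 \<in> subformulae \<phi>"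
        using sub[OF *(3)] by auto
      have "lab (Imp \<psi>1 \<psi>2) \<in> ?t w \<longleftrightarrow>
          (\<forall>v\<in>?W. type_leq m (?t w) (?t v) \<longrightarrow> lab \<psi>1 \<in> ?t v \<longrightarrow> lab \<psi>2 \<in> ?t v)"
        if w: "w \<in> ?W" for w
      proof
        assume wi: "lab (Imp \<psi>1 \<psi>2) \<in> ?t w"
        show "\<forall>v\<in>?W. type_leq m (?t w) (?t v) \<longrightarrow> lab \<psi>1 \<in> ?t v \<longrightarrow> lab \<psi>2 \<in> ?t v"
        proof (intro ballI impI)
          fix v assume v: "v \<in> ?W" "type_leq m (?t w) (?t v)" "lab \<psi>1 \<in> ?t v"
          \<comment> \<open>A filtrated edge need not come from \<open>leq F\<close>, so the whole
            implication is moved to \<open>v\<close> and used there through reflexivity of the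
            order.\<close>
          have "?t w \<subseteq> ?t v" using v(2) by (simp add: type_leq_def)
          then have "lab (Imp \<psi>1 \<psi>2) \<in> ?t v" using wi by blast
          then have "truth F V v (Imp \<psi>1 \<psi>2)" "truth F V v \<psi>1" using v by simp_all
          then show "lab \<psi>2 \<in> ?t v"
            using v(1) s epistemic_frame_leq(2)[OF E] by simp
        qed
      next
        assume "\<forall>v\<in>?W. type_leq m (?t w) (?t v) \<longrightarrow> lab \<psi>1 \<in> ?t v \<longrightarrow> lab \<psi>2 \<in> ?t v"
        then show "lab (Imp \<psi>1 \<psi>2) \<in> ?t w"
          using world_type_leq[OF F V] * s epistemic_frame_leq(1)[OF E]
          by (auto simp del: lab_simps[symmetric])
      qed
      then show "x \<in> ?\<Sigma> \<and> y \<in> ?\<Sigma> \<and>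
        (\<forall>T\<in>?t ` ?W. limp x y \<in> T \<longleftrightarrow> (\<forall>S\<in>?t ` ?W. type_leq m T S \<longrightarrow> x \<in> S \<longrightarrow> y \<in> S))"
        using * s by (simp del: mem_world_type)
    qed
    show "\<forall>a x. lknow a x \<in> ?\<Sigma> \<longrightarrow> x \<in> ?\<Sigma> \<and>
        (\<forall>T\<in>?t ` ?W. lknow a x \<in> T \<longleftrightarrow> (\<forall>S\<in>?t ` ?W. type_acc m a T S \<longrightarrow> x \<in> S))"
    proof (intro allI impI)
      fix a x assume "lknow a x \<in> ?\<Sigma>"
      then obtain \<chi> where "lab \<chi> = lknow a x" "\<chi> \<in> subformulae \<phi>" by (metis imageE)
      then obtain \<psi> where *: "x = lab \<psi>" "Know a \<psi> \<in> subformulae \<phi>"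
        unfolding lab_know by blast
      then have s: "\<psi> \<in> subformulae \<phi>" using sub[OF *(2)] by auto
      have "lab (Know a \<psi>) \<in> ?t w \<longleftrightarrow> (\<forall>v\<in>?W. type_acc m a (?t w) (?t v) \<longrightarrow> lab \<psi> \<in> ?t v)"
        if w: "w \<in> ?W" for w
      proof
        assume wi: "lab (Know a \<psi>) \<in> ?t w"
        show "\<forall>v\<in>?W. type_acc m a (?t w) (?t v) \<longrightarrow> lab \<psi> \<in> ?t v"
        proof (intro ballI impI)
          fix v assume v: "v \<in> ?W" and acc: "type_acc m a (?t w) (?t v)"
          show "lab \<psi> \<in> ?t v"
          proof (cases "m = SysK \<or> m = SysT")
            case True
            then have "\<forall>x. lknow a x \<in> ?t w \<longrightarrow> x \<in> ?t v" using acc by auto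
            then show ?thesis using wi by (simp only: lab_simps)
          next
            case False
            then have "lab (Know a \<psi>) \<in> ?t v"
              using acc wi by (cases m) (auto simp: lab_simps(4) simp del: lab_simps[symmetric] mem_world_type)
            \<comment> \<open>In S4 and S5 the edge delivers only the \<open>Know\<close> formula;
              reflexivity of the original frame at \<open>v\<close> yields its body.\<close>
            moreover have "(v, v) \<in> acc F a" using frame_class_refl[OF F] False v by auto
            ultimately show ?thesis using s by simp
          qed
        qed
      next
        assume "\<forall>v\<in>?W. type_acc m a (?t w) (?t v) \<longrightarrow> lab \<psi> \<in> ?t v"
        moreover have "v \<in> ?W" if "(w, v) \<in> acc F a" for v
          using E that by (auto simp: epistemic_frame_def)
        ultimately show "lab (Know a \<psi>) \<in> ?t w"
          using world_type_acc[OF F] *(2) by auto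
      qed
      then show "x \<in> ?\<Sigma> \<and>
          (\<forall>T\<in>?t ` ?W. lknow a x \<in> T \<longleftrightarrow> (\<forall>S\<in>?t ` ?W. type_acc m a T S \<longrightarrow> x \<in> S))"
        using * s by (simp del: mem_world_type)
    qed
    show "\<forall>x. lcommon x \<in> ?\<Sigma> \<longrightarrow> x \<in> ?\<Sigma> \<and> common_condition m (?t ` ?W) x"
    proof (intro allI impI)
      fix x assume "lcommon x \<in> ?\<Sigma>"
      then obtain \<chi> where "lab \<chi> = lcommon x" "\<chi> \<in> subformulae \<phi>" by (metis imageE)
      then obtain \<psi> where *: "x = lab \<psi>" "Common \<psi> \<in> subformulae \<phi>"
        unfolding lab_common by blast
      then have s: "\<psi> \<in> subformulae \<phi>" using sub[OF *(2)] by auto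
      have "common_condition m (?t ` ?W) (lab \<psi>)"
        unfolding common_condition_def
      proof (intro conjI allI impI ballI)
        fix T assume "T \<in> ?t ` ?W" "lcommon (lab \<psi>) \<in> T"
        then show "lab \<psi> \<in> T" using s by auto
      next
        fix X T assume X: "X \<subseteq> ?t ` ?W" "\<forall>T\<in>X. lab \<psi> \<in> T"
          "\<forall>T\<in>X. \<forall>S\<in>?t ` ?W. (\<exists>a. type_acc m a T S) \<longrightarrow> S \<in> X" and T: "T \<in> X"
        then obtain w where w: "w \<in> ?W" "T = ?t w" by auto
        \<comment> \<open>Original edges are filtrated edges, so a path starting in the closed set
          \<open>X\<close> never leaves it.\<close>
        have "v \<in> ?W \<and> ?t v \<in> X" if "(w, v) \<in> (\<Union>a. acc F a)\<^sup>*" for v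
          using that
        proof induction
          case base
          then show ?case using w T by simp
        next
          case (step v u)
          then obtain a where a: "(v, u) \<in> acc F a" by auto
          then have "u \<in> ?W" using E by (auto simp: epistemic_frame_def)
          then show ?case using world_type_acc[OF F a] step X(3) by blast
        qed
        then have "truth F V v \<psi>" if "(w, v) \<in> (\<Union>a. acc F a)\<^sup>*" for v
          using that X(2) by fastforce
        then show "lcommon (lab \<psi>) \<in> T" using * w by simp
      qed
      then show "x \<in> ?\<Sigma> \<and> common_condition m (?t ` ?W) x" using * s by simp
    qed
    show "m = SysT \<longrightarrow> (\<forall>T\<in>?t ` ?W. \<forall>a. type_acc m a T T)"
      using world_type_acc[OF F] frame_class_refl[OF F] by (auto simp del: type_acc.simps)
  qed
qed

text \<open>The bound by \<open>Pow\<close> depends on the formula alone, however large the original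
  model is; both finiteness and the search bound come from it.\<close>

lemma not_valid_type_model:
  assumes "\<phi> \<notin> valid_formulae (frame_class m :: ('a, 'w) frame \<Rightarrow> bool)"
  shows "\<exists>H\<subseteq>Pow (lab ` subformulae \<phi>). type_model m (lab ` subformulae \<phi>) H \<and> (\<exists>T\<in>H. lab \<phi> \<notin> T)"
proof -
  obtain F :: "('a, 'w) frame" and V w where F: "frame_class m F" "valuation_on F V"
    and w: "w \<in> worlds F" "\<not> truth F V w \<phi>"
    using assms by (auto simp: valid_formulae_def)
  show ?thesis
  proof (intro exI conjI)
    show "world_type \<phi> F V ` worlds F \<subseteq> Pow (lab ` subformulae \<phi>)"
      by (auto simp: world_type_def)
    show "type_model m (lab ` subformulae \<phi>) (world_type \<phi> F V ` worlds F)"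
      by (rule type_model_world_types[OF F])
    show "\<exists>T\<in>world_type \<phi> F V ` worlds F. lab \<phi> \<notin> T"
      using w by (auto simp: mem_world_type)
  qed
qed

end

section \<open>The finite model property\<close>

interpretation formulae: formula_labels "\<lambda>\<phi> :: ('a, 'p) fm. \<phi>" And Or Imp Know Common
  by unfold_locales auto

lemma finite_model_property_frame_class:
  "finite_model_property (valid_formulae (frame_class m :: ('a, 'w) frame \<Rightarrow> bool) :: ('a, 'p) fm set)
     (frame_class m :: ('a, nat) frame \<Rightarrow> bool)"
  unfolding finite_model_property_def
proof (intro allI impI)
  fix \<phi> :: "('a, 'p) fm"
  assume "\<phi> \<notin> valid_formulae (frame_class m :: ('a, 'w) frame \<Rightarrow> bool)"
  from formulae.not_valid_type_model[OF this] obtain H T where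
    H: "H \<subseteq> Pow (subformulae \<phi>)" "formulae.type_model m (subformulae \<phi>) H" "T \<in> H" "\<phi> \<notin> T"
    by auto
  have "finite H" using finite_subset[OF H(1)] by (simp add: finite_subformulae)
  then obtain th where th: "bij_betw th {0..<card H} H"
    using ex_bij_betw_nat_finite by blast
  show "\<exists>(F :: ('a, nat) frame) V. frame_class m F \<and> finite (worlds F) \<and> valuation_on F V \<and>
      (\<exists>w\<in>worlds F. \<not> truth F V w \<phi>)"
  proof -
    obtain F :: "('a, nat) frame" and V where "frame_class m F" "worlds F = {0..<card H}"
      "valuation_on F V" "\<exists>w\<in>worlds F. \<not> truth F V w \<phi>"
      using formulae.type_model_countermodel[OF H(2) th subformulae_self H(3,4)] by blast
    then show ?thesis by (intro exI[of _ F] exI[of _ V]) auto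
  qed
qed


section \<open>Recursive functions of an environment\<close>

text \<open>Variables \<open>e i\<close> of an environment replace list positions, so that arities need not be tracked;
  a bound variable becomes \<open>e 0\<close> and shifts the others by one.\<close>

definition computable :: "((nat \<Rightarrow> nat) \<Rightarrow> nat) \<Rightarrow> bool" where
  "computable F \<longleftrightarrow> (\<exists>n g. recursive n g \<and> (\<forall>e. g (map e [0..<n]) = F e))"

text \<open>Surplus arguments are discarded by projections. This allows functions of different
  arities to be brought to a common one, as \<open>recursive.comp\<close> requires.\<close>

lemma computable_arity:
  assumes "computable F"
  shows "\<exists>n. \<forall>m\<ge>n. \<exists>g. recursive m g \<and> (\<forall>e. g (map e [0..<m]) = F e)"
proof -
  obtain n g where g: "recursive n g" "\<And>e. g (map e [0..<n]) = F e"
    using assms by (auto simp: computable_def)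
  have "\<exists>g. recursive m g \<and> (\<forall>e. g (map e [0..<m]) = F e)" if "m \<ge> n" for m
  proof -
    let ?ps = "map (\<lambda>i xs. xs ! i) [0..<n] :: (nat list \<Rightarrow> nat) list"
    have "recursive m (\<lambda>xs. g (map (\<lambda>f. f xs) ?ps))"
      by (rule recursive.comp) (use g that in \<open>auto intro: recursive.proj\<close>)
    moreover have "map (\<lambda>f. f (map e [0..<m])) ?ps = map e [0..<n]" for e
      using that by (auto intro!: nth_equalityI)
    ultimately show ?thesis using g by metis
  qed
  then show ?thesis by blast
qed

lemma computable_arities:
  assumes "\<forall>F\<in>set Fs. computable F"
  shows "\<exists>n. \<forall>m\<ge>n. \<exists>gs. length gs = length Fs \<and> (\<forall>g\<in>set gs. recursive m g) \<and>
           (\<forall>e. map (\<lambda>g. g (map e [0..<m])) gs = map (\<lambda>F. F e) Fs)"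
  using assms
proof (induction Fs)
  case Nil
  then show ?case by simp
next
  case (Cons F Fs)
  then obtain n1 where n1: "\<And>m. m \<ge> n1 \<Longrightarrow> \<exists>gs. length gs = length Fs \<and>
      (\<forall>g\<in>set gs. recursive m g) \<and>
      (\<forall>e. map (\<lambda>g. g (map e [0..<m])) gs = map (\<lambda>F. F e) Fs)"
    by auto
  obtain n2 where n2: "\<And>m. m \<ge> n2 \<Longrightarrow> \<exists>g. recursive m g \<and> (\<forall>e. g (map e [0..<m]) = F e)"
    using computable_arity[of F] Cons.prems by auto
  show ?case
  proof (rule exI, intro allI impI)
    fix m assume m: "m \<ge> max n1 n2"
    obtain gs where gs: "length gs = length Fs" "\<forall>g\<in>set gs. recursive m g"
      "\<And>e. map (\<lambda>g. g (map e [0..<m])) gs = map (\<lambda>F. F e) Fs"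
      using n1[of m] m by auto
    obtain g where g: "recursive m g" "\<And>e. g (map e [0..<m]) = F e"
      using n2[of m] m by auto
    show "\<exists>gs. length gs = length (F # Fs) \<and> (\<forall>g\<in>set gs. recursive m g) \<and>
           (\<forall>e. map (\<lambda>g. g (map e [0..<m])) gs = map (\<lambda>F. F e) (F # Fs))"
      by (rule exI[of _ "g # gs"]) (use g gs in auto)
  qed
qed

lemma computable_compose:
  assumes h: "recursive k h" and k: "k = length Fs" and Fs: "\<forall>F\<in>set Fs. computable F"
  shows "computable (\<lambda>e. h (map (\<lambda>F. F e) Fs))"
proof -
  obtain m gs where gs: "length gs = length Fs" "\<forall>g\<in>set gs. recursive m g"
      "\<And>e. map (\<lambda>g. g (map e [0..<m])) gs = map (\<lambda>F. F e) Fs"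
    using computable_arities[OF Fs] by blast
  have "recursive m (\<lambda>xs. h (map (\<lambda>g. g xs) gs))"
    by (rule recursive.comp) (use gs h k in auto)
  then show ?thesis using gs(3) unfolding computable_def by metis
qed

lemma computable_var: "computable (\<lambda>e. e i)"
  unfolding computable_def
  by (rule exI[of _ "Suc i"], rule exI[of _ "\<lambda>xs. xs ! i"]) (auto intro: recursive.proj simp del: upt_Suc)

lemma computable_Suc: "computable F \<Longrightarrow> computable (\<lambda>e. Suc (F e))"
  using computable_compose[OF recursive.succ, of "[F]"] by simp

lemma computable_const: "computable (\<lambda>e. c)"
proof (induction c)
  case 0
  have "recursive 0 (\<lambda>xs. 0)" by (rule recursive.zero)
  then show ?case unfolding computable_def by blast
qed (rule computable_Suc)

text \<open>The body sees the counter as variable 0, the previous value as variable 1 and the outer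
  environment shifted by two, matching the argument list \<open>k # r # tl xs\<close> of
  \<open>prim_rec\<close>.\<close>

lemma computable_rec_nat:
  assumes "computable F" "computable N"
    and "computable (\<lambda>e. G (e 0) (e (Suc 0)) (\<lambda>i. e (Suc (Suc i))))"
  shows "computable (\<lambda>e. rec_nat (F e) (\<lambda>k r. G k r e) (N e))"
proof -
  obtain n1 where n1: "\<And>m. m \<ge> n1 \<Longrightarrow> \<exists>g. recursive m g \<and> (\<forall>e. g (map e [0..<m]) = F e)"
    using computable_arity[OF assms(1)] by blast
  obtain n2 where n2: "\<And>m. m \<ge> n2 \<Longrightarrow> \<exists>h. recursive m h \<and>
      (\<forall>e. h (map e [0..<m]) = G (e 0) (e (Suc 0)) (\<lambda>i. e (Suc (Suc i))))"
    using computable_arity[OF assms(3)] by blast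
  define m where "m = max n1 n2"
  obtain g where g: "recursive m g" "\<And>e. g (map e [0..<m]) = F e"
    using n1[of m] by (auto simp: m_def)
  obtain h where h: "recursive (Suc (Suc m)) h"
      "\<And>e. h (map e [0..<Suc (Suc m)]) = G (e 0) (e (Suc 0)) (\<lambda>i. e (Suc (Suc i)))"
    using n2[of "Suc (Suc m)"] by (metis le_SucI m_def max.cobounded2)
  have h': "h (k # r # map e [0..<m]) = G k r e" for k r e
  proof -
    \<comment> \<open>The nested \<open>case_nat\<close> is the environment \<open>e\<close> with
      \<open>k\<close> and \<open>r\<close> pushed in front.\<close>
    have "map (case_nat k (case_nat r e)) [0..<Suc (Suc m)] = k # r # map e [0..<m]"
      by (simp add: upt_conv_Cons map_Suc_upt[symmetric] del: upt_Suc)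
    then show ?thesis using h(2)[of "case_nat k (case_nat r e)"] by simp
  qed
  let ?P = "\<lambda>xs. rec_nat (g (tl xs)) (\<lambda>k r. h (k # r # tl xs)) (hd xs)"
  have "computable (\<lambda>e. ?P (map (\<lambda>F. F e) (N # map (\<lambda>i e. e i) [0..<m])))"
    by (rule computable_compose[OF recursive.prim_rec[OF g(1) h(1)]])
      (auto intro: computable_var assms)
  then show ?thesis
    by (simp add: comp_def g h')
qed

text \<open>Only the first \<open>n\<close> variables are read, so this is a finite composition.
  Later facts are therefore proved for plain variables and instantiated.\<close>

lemma computable_subst:
  assumes "computable F" "\<And>i. computable (\<sigma> i)"
  shows "computable (\<lambda>e. F (\<lambda>i. \<sigma> i e))"
proof -
  obtain n g where g: "recursive n g" "\<And>e. g (map e [0..<n]) = F e"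
    using assms by (auto simp: computable_def)
  have "computable (\<lambda>e. g (map (\<lambda>F. F e) (map \<sigma> [0..<n])))"
    by (rule computable_compose[OF g(1)]) (use assms in auto)
  moreover have "g (map (\<lambda>F. F e) (map \<sigma> [0..<n])) = F (\<lambda>i. \<sigma> i e)" for e
    using g(2)[of "\<lambda>i. \<sigma> i e"] by (simp add: comp_def)
  ultimately show ?thesis by simp
qed

lemma computable_apply:
  assumes "computable (\<lambda>e. f (e 0))" "computable F"
  shows "computable (\<lambda>e. f (F e))"
  using computable_subst[OF assms(1), of "\<lambda>_. F"] assms(2) by simp

lemma computable_apply2:
  assumes "computable (\<lambda>e. f (e 0) (e (Suc 0)))" "computable F" "computable G"
  shows "computable (\<lambda>e. f (F e) (G e))"
proof -
  have "computable ((case_nat F (\<lambda>_. G)) i)" for i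
    using assms(2,3) by (cases i) auto
  from computable_subst[OF assms(1), of "case_nat F (\<lambda>_. G)", OF this] show ?thesis by simp
qed

section \<open>Arithmetic and pairing by primitive recursion\<close>

lemma computable_add: "computable F \<Longrightarrow> computable G \<Longrightarrow> computable (\<lambda>e. F e + G e)"
proof (rule computable_apply2[where f = "(+)"])
  have "computable (\<lambda>e. rec_nat (e 0) (\<lambda>_. Suc) (e (Suc 0)))"
    by (intro computable_rec_nat computable_Suc computable_var)
  moreover have "rec_nat a (\<lambda>_. Suc) b = a + b" for a b
    by (induction b) auto
  ultimately show "computable (\<lambda>e. e 0 + e (Suc 0))" by (simp only:)
qed

lemma computable_mult: "computable F \<Longrightarrow> computable G \<Longrightarrow> computable (\<lambda>e. F e * G e)"
proof (rule computable_apply2[where f = "(*)"])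
  have "computable (\<lambda>e. rec_nat 0 (\<lambda>_ r. r + e 0) (e (Suc 0)))"
    by (intro computable_rec_nat computable_add computable_const computable_var)
  moreover have "rec_nat 0 (\<lambda>_ r. r + a) b = a * b" for a b :: nat
    by (induction b) auto
  ultimately show "computable (\<lambda>e. e 0 * e (Suc 0))" by (simp only:)
qed

lemma computable_power: "computable F \<Longrightarrow> computable G \<Longrightarrow> computable (\<lambda>e. F e ^ G e)"
proof (rule computable_apply2[where f = "(^)"])
  have "computable (\<lambda>e. rec_nat 1 (\<lambda>_ r. r * e 0) (e (Suc 0)))"
    by (intro computable_rec_nat computable_mult computable_const computable_var)
  moreover have "rec_nat 1 (\<lambda>_ r. r * a) b = a ^ b" for a b :: nat
    by (induction b) auto
  ultimately show "computable (\<lambda>e. e 0 ^ e (Suc 0))" by (simp only:)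
qed

lemma computable_pred: "computable F \<Longrightarrow> computable (\<lambda>e. F e - 1)"
proof (rule computable_apply[where f = "\<lambda>x. x - 1"])
  have "computable (\<lambda>e. rec_nat 0 (\<lambda>k _. k) (e 0))"
    by (intro computable_rec_nat computable_const computable_var)
  moreover have "rec_nat 0 (\<lambda>k _. k) b = b - 1" for b :: nat
    by (cases b) auto
  ultimately show "computable (\<lambda>e. e 0 - 1)" by (simp only:)
qed

lemma computable_diff: "computable F \<Longrightarrow> computable G \<Longrightarrow> computable (\<lambda>e. F e - G e)"
proof (rule computable_apply2[where f = "(-)"])
  have "computable (\<lambda>e. rec_nat (e 0) (\<lambda>_ r. r - 1) (e (Suc 0)))"
    by (intro computable_rec_nat computable_pred computable_var)
  moreover have "rec_nat a (\<lambda>_ r. r - 1) b = a - b" for a b :: nat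
    by (induction b) auto
  ultimately show "computable (\<lambda>e. e 0 - e (Suc 0))" by (simp only:)
qed

lemma computable_prod_encode:
  assumes "computable F" "computable G"
  shows "computable (\<lambda>e. prod_encode (F e, G e))"
proof -
  \<comment> \<open>Cantor pairing of \<open>m\<close> and \<open>n\<close> is the triangular number
    of \<open>m + n\<close>, increased by \<open>m\<close>.\<close>
  have "computable (\<lambda>e. rec_nat 0 (\<lambda>k r. r + Suc k) (F e + G e) + F e)"
    by (intro computable_rec_nat computable_add computable_Suc computable_const computable_var assms)
  moreover have "rec_nat 0 (\<lambda>k r. r + Suc k) b = triangle b" for b
    by (induction b) auto
  ultimately show ?thesis by (simp only: prod_encode_def case_prod_conv)
qed

section \<open>Relations through characteristic functions, and bounded quantifiers\<close>

definition computable_rel :: "((nat \<Rightarrow> nat) \<Rightarrow> bool) \<Rightarrow> bool" where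
  "computable_rel P \<longleftrightarrow> computable (\<lambda>e. of_bool (P e))"

lemma computable_rel_const: "computable_rel (\<lambda>e. P)"
  unfolding computable_rel_def by (rule computable_const)

lemma of_bool_not_iff_nat: "of_bool (\<not> P) = (1 - of_bool P :: nat)"
  by simp

lemma computable_rel_not: "computable_rel P \<Longrightarrow> computable_rel (\<lambda>e. \<not> P e)"
  unfolding computable_rel_def of_bool_not_iff_nat
  by (intro computable_diff computable_const)

lemma computable_rel_conj:
  "computable_rel P \<Longrightarrow> computable_rel Q \<Longrightarrow> computable_rel (\<lambda>e. P e \<and> Q e)"
  unfolding computable_rel_def of_bool_conj by (rule computable_mult)

lemma computable_rel_imp:
  assumes "computable_rel P" "computable_rel Q"
  shows "computable_rel (\<lambda>e. P e \<longrightarrow> Q e)"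
proof -
  have "computable_rel (\<lambda>e. \<not> (P e \<and> \<not> Q e))"
    by (intro computable_rel_not computable_rel_conj assms)
  then show ?thesis by simp
qed

lemma computable_rel_disj:
  assumes "computable_rel P" "computable_rel Q"
  shows "computable_rel (\<lambda>e. P e \<or> Q e)"
proof -
  have "computable_rel (\<lambda>e. \<not> P e \<longrightarrow> Q e)"
    by (intro computable_rel_not computable_rel_imp assms)
  then show ?thesis by (simp add: disj_imp)
qed

lemma computable_rel_iff:
  assumes "computable_rel P" "computable_rel Q"
  shows "computable_rel (\<lambda>e. P e \<longleftrightarrow> Q e)"
  unfolding iff_conv_conj_imp by (intro computable_rel_conj computable_rel_imp assms)

lemma computable_rel_le:
  assumes "computable F" "computable G"
  shows "computable_rel (\<lambda>e. F e \<le> G e)"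
proof -
  \<comment> \<open>Subtraction is truncated, so \<open>a - b\<close> vanishes exactly when the
    inequality holds.\<close>
  have "of_bool (a \<le> b) = 1 - (a - b)" for a b :: nat by auto
  then show ?thesis unfolding computable_rel_def
    by (simp only:) (intro computable_diff computable_const assms)
qed

lemma computable_rel_eq:
  assumes "computable F" "computable G"
  shows "computable_rel (\<lambda>e. F e = G e)"
  unfolding order_eq_iff by (intro computable_rel_conj computable_rel_le assms)

text \<open>A bounded universal quantifier is a product of characteristic values, accumulated by
  primitive recursion.\<close>

lemma computable_rel_all_less:
  assumes "computable F" "computable_rel (\<lambda>e. P (e 0) (\<lambda>i. e (Suc i)))"
  shows "computable_rel (\<lambda>e. \<forall>k<F e. P k e)"
proof -
  have "of_bool (\<forall>k<n. P k e) = rec_nat (1 :: nat) (\<lambda>k r. r * of_bool (P k e)) n" for n e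
  proof (induction n)
    case (Suc n)
    have "of_bool (\<forall>k<Suc n. P k e) = of_bool (\<forall>k<n. P k e) * (of_bool (P n e) :: nat)"
      by (auto simp: All_less_Suc)
    then show ?case using Suc by simp
  qed simp
  moreover have "computable (\<lambda>e. rec_nat 1 (\<lambda>k r. r * of_bool (P k e)) (F e))"
  proof (intro computable_rec_nat computable_mult computable_const computable_var assms(1))
    \<comment> \<open>The substitution skips variable 1, the accumulated product, which
      \<open>P\<close> must not see.\<close>
    have "computable (\<lambda>e. (\<lambda>e. of_bool (P (e 0) (\<lambda>i. e (Suc i))))
        (\<lambda>i. case i of 0 \<Rightarrow> e 0 | Suc j \<Rightarrow> e (Suc (Suc j))))"
      using assms(2) unfolding computable_rel_def
    proof (rule computable_subst)
      show "computable (\<lambda>e. case i of 0 \<Rightarrow> e 0 | Suc j \<Rightarrow> e (Suc (Suc j)))" for i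
        by (cases i) (auto intro: computable_var)
    qed
    then show "computable (\<lambda>e. of_bool (P (e 0) (\<lambda>i. e (Suc (Suc i)))))"
      by simp
  qed
  ultimately show ?thesis unfolding computable_rel_def by simp
qed

lemma computable_rel_ex_less:
  assumes "computable F" "computable_rel (\<lambda>e. P (e 0) (\<lambda>i. e (Suc i)))"
  shows "computable_rel (\<lambda>e. \<exists>k<F e. P k e)"
proof -
  have "computable_rel (\<lambda>e. \<not> (\<forall>k<F e. \<not> P k e))"
    by (intro computable_rel_not computable_rel_all_less assms)
  then show ?thesis by simp
qed

text \<open>For quantifiers over agents: a finite conjunction with one instance per agent, each with
  its own constant \<open>ea a\<close>.\<close>

lemma computable_rel_all_finite:
  fixes P :: "'a::finite \<Rightarrow> _"
  assumes "\<And>a. computable_rel (P a)"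
  shows "computable_rel (\<lambda>e. \<forall>a. P a e)"
proof -
  have "computable_rel (\<lambda>e. \<forall>a\<in>A. P a e)" if "finite A" for A
    using that by (induction A) (auto intro: computable_rel_const computable_rel_conj assms)
  from this[of UNIV] show ?thesis by simp
qed

lemma computable_rel_ex_finite:
  fixes P :: "'a::finite \<Rightarrow> _"
  assumes "\<And>a. computable_rel (P a)"
  shows "computable_rel (\<lambda>e. \<exists>a. P a e)"
proof -
  have "computable_rel (\<lambda>e. \<not> (\<forall>a. \<not> P a e))"
    by (intro computable_rel_not computable_rel_all_finite assms)
  then show ?thesis by simp
qed

lemma computable_rel_set_decode:
  assumes "computable F" "computable G"
  shows "computable_rel (\<lambda>e. F e \<in> set_decode (G e))"
proof -
  \<comment> \<open>Bit \<open>x\<close> of \<open>s\<close> is set iff \<open>s div 2 ^ x\<close>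
    is odd. Writing out quotient and remainder avoids division; \<open>q\<close> is at most
    \<open>s\<close>, hence the bound \<open>Suc s\<close>.\<close>
  have "x \<in> set_decode s \<longleftrightarrow> (\<exists>q<Suc s. \<exists>r<2 ^ x. s = (2 * q + 1) * 2 ^ x + r)" for x s
  proof
    assume "x \<in> set_decode s"
    then obtain q where q: "s div 2 ^ x = 2 * q + 1"
      by (auto simp: set_decode_def elim: oddE)
    then have "s = (2 * q + 1) * 2 ^ x + s mod 2 ^ x"
      by (metis div_mult_mod_eq)
    moreover have "q \<le> s div 2 ^ x" using q by simp
    then have "q < Suc s" by (meson div_le_dividend le_trans less_Suc_eq_le)
    ultimately show "\<exists>q<Suc s. \<exists>r<2 ^ x. s = (2 * q + 1) * 2 ^ x + r"
      by (metis mod_less_divisor zero_less_numeral zero_less_power)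
  next
    assume "\<exists>q<Suc s. \<exists>r<2 ^ x. s = (2 * q + 1) * 2 ^ x + r"
    then obtain q r where "r < 2 ^ x" "s = (2 * q + 1) * 2 ^ x + r" by blast
    then have "s div 2 ^ x = 2 * q + 1"
      by (metis add.right_neutral div_less div_mult_self3 power_not_zero zero_neq_numeral)
    then show "x \<in> set_decode s" by (simp add: set_decode_def)
  qed
  then have "computable_rel (\<lambda>e. e 0 \<in> set_decode (e (Suc 0)))"
    by (simp only:) (intro computable_rel_ex_less computable_rel_eq computable_add computable_mult
        computable_power computable_Suc computable_const computable_var)
  then show ?thesis
    using computable_apply2[where f = "\<lambda>x s. of_bool (x \<in> set_decode s)"] assms
    by (simp add: computable_rel_def)
qed


section \<open>Bounded search for countermodels\<close>

text \<open>An element \<open>k\<close> contributes \<open>2 ^ k > k\<close> to the code. Thus the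
  code of a set bounds every quantifier over its elements.\<close>

lemma mem_set_decode_less: "k \<in> set_decode s \<Longrightarrow> k < s"
proof -
  assume "k \<in> set_decode s"
  then have "s div 2 ^ k \<noteq> 0" by (auto simp: set_decode_def intro: ccontr)
  then have "2 ^ k \<le> s" by (auto simp: div_eq_0_iff)
  then show "k < s" using less_exp[of k] by (rule less_le_trans[rotated])
qed

lemma le_prod_encode_pair:
  "z \<le> x \<Longrightarrow> z \<le> prod_encode (k, prod_encode (x, y))"
  "z \<le> y \<Longrightarrow> z \<le> prod_encode (k, prod_encode (x, y))"
  by (meson le_prod_encode_1 le_prod_encode_2 le_trans)+

lemma computable_rel_ball_set_decode:
  assumes "computable F" "computable_rel (\<lambda>e. P (e 0) (\<lambda>i. e (Suc i)))"
  shows "computable_rel (\<lambda>e. \<forall>k\<in>set_decode (F e). P k e)"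
proof -
  \<comment> \<open>Under the bound variable the outer environment starts at
    \<open>e (Suc 0)\<close>, so \<open>F\<close> is needed in shifted form.\<close>
  have "computable (\<lambda>e. F (\<lambda>i. e (Suc i)))"
    using computable_subst[OF assms(1), of "\<lambda>i e. e (Suc i)"] by (simp add: computable_var)
  then have "computable_rel (\<lambda>e. \<forall>k<F e. k \<in> set_decode (F e) \<longrightarrow> P k e)"
    by (intro computable_rel_all_less computable_rel_imp computable_rel_set_decode
        computable_var assms)
  moreover have "(\<forall>k<F e. k \<in> set_decode (F e) \<longrightarrow> P k e) \<longleftrightarrow> (\<forall>k\<in>set_decode (F e). P k e)" for e
    using mem_set_decode_less by blast
  ultimately show ?thesis by (simp only:)
qed

lemma computable_rel_bex_set_decode:
  assumes "computable F" "computable_rel (\<lambda>e. P (e 0) (\<lambda>i. e (Suc i)))"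
  shows "computable_rel (\<lambda>e. \<exists>k\<in>set_decode (F e). P k e)"
proof -
  have "computable_rel (\<lambda>e. \<not> (\<forall>k\<in>set_decode (F e). \<not> P k e))"
    by (intro computable_rel_not computable_rel_ball_set_decode assms)
  then show ?thesis by simp
qed

lemmas computable_intros =
  computable_var computable_const computable_Suc computable_power computable_prod_encode
  computable_rel_const computable_rel_not computable_rel_conj computable_rel_disj computable_rel_imp computable_rel_iff
  computable_rel_all_less computable_rel_ex_less
  computable_rel_ball_set_decode computable_rel_bex_set_decode
  computable_rel_all_finite computable_rel_ex_finite computable_rel_set_decode

lemma computable_unary:
  assumes "computable (\<lambda>e. f (e 0))"
  shows "\<exists>g. recursive 1 g \<and> (\<forall>c. g [c] = f c)"
proof -
  obtain n g where g: "recursive n g" "\<And>e. g (map e [0..<n]) = f (e 0)"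
    using assms by (auto simp: computable_def)
  let ?fs = "replicate n (\<lambda>xs :: nat list. xs ! 0)"
  have "recursive 1 (\<lambda>xs. g (map (\<lambda>f. f xs) ?fs))"
    by (rule recursive.comp) (use g in \<open>auto intro: recursive.proj\<close>)
  \<comment> \<open>All \<open>n\<close> arguments are fed the same input, which is the constant
    environment.\<close>
  moreover have "g (map (\<lambda>f. f [c]) ?fs) = f c" for c
    using g(2)[of "\<lambda>_. c"] by (simp add: map_replicate_const)
  ultimately show ?thesis by blast
qed

lemma set_encode_less: "A \<subseteq> {..<n} \<Longrightarrow> set_encode A < 2 ^ n"
proof -
  assume "A \<subseteq> {..<n}"
  then have "set_encode A \<le> (\<Sum>i\<in>{0..<n}. 2 ^ i)"
    unfolding set_encode_def by (intro sum_mono2) auto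
  also have "\<dots> < 2 ^ n" by (simp add: sum_power2)
  finally show ?thesis .
qed

text \<open>A pair code is at least as large as its components, and it is below the code of a set
  containing it. So a quantifier guarded by membership can be bounded by that code.\<close>

lemma all_pair_bound:
  "(\<forall>x y. prod_encode (k, prod_encode (x, y)) \<in> set_decode s \<longrightarrow> Q x y) \<longleftrightarrow>
   (\<forall>x<s. \<forall>y<s. prod_encode (k, prod_encode (x, y)) \<in> set_decode s \<longrightarrow> Q x y)"
  by (meson le_less_trans le_prod_encode_1 le_prod_encode_2 mem_set_decode_less)

lemma all_know_bound:
  "(\<forall>x. prod_encode (k, prod_encode (c, x)) \<in> set_decode s \<longrightarrow> Q x) \<longleftrightarrow>
   (\<forall>x<s. prod_encode (k, prod_encode (c, x)) \<in> set_decode s \<longrightarrow> Q x)"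
  by (meson le_less_trans le_prod_encode_2 mem_set_decode_less)

lemma all_common_bound:
  "(\<forall>x. prod_encode (k, x) \<in> set_decode s \<longrightarrow> Q x) \<longleftrightarrow>
   (\<forall>x<s. prod_encode (k, x) \<in> set_decode s \<longrightarrow> Q x)"
  by (meson le_less_trans le_prod_encode_2 mem_set_decode_less)

lemma inj_set_decode: "inj set_decode"
  by (metis injI set_decode_inverse)

text \<open>The code of a subset is at most the code of the set. This bounds the quantification over
  closed sets in \<open>common_condition\<close>.\<close>

lemma all_subset_set_decode:
  "(\<forall>X\<subseteq>set_decode ` set_decode h. P X) \<longleftrightarrow>
   (\<forall>y<Suc h. (\<forall>t\<in>set_decode y. t \<in> set_decode h) \<longrightarrow> P (set_decode ` set_decode y))"
proof -
  have "(\<forall>Y\<subseteq>set_decode h. P (set_decode ` Y)) \<longleftrightarrow>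
    (\<forall>y<Suc h. set_decode y \<subseteq> set_decode h \<longrightarrow> P (set_decode ` set_decode y))"
  proof (intro iffI allI impI)
    fix Y assume *: "\<forall>y<Suc h. set_decode y \<subseteq> set_decode h \<longrightarrow> P (set_decode ` set_decode y)"
      and Y: "Y \<subseteq> set_decode h"
    then have "set_decode (set_encode Y) = Y"
      by (meson finite_set_decode finite_subset set_encode_inverse)
    then show "P (set_decode ` Y)"
      using * Y by (metis le_imp_less_Suc subset_decode_imp_le)
  qed blast
  then show ?thesis unfolding all_subset_image by (simp only: subset_eq)
qed

text \<open>A set \<open>X\<close> of types over natural number labels is coded by iterating the coding of finite sets:
  \<open>X = set_decode ` set_decode h\<close>.\<close>

locale goedel_numbering =
  fixes ea :: "'a::finite \<Rightarrow> nat" and ep :: "'p \<Rightarrow> nat"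
  assumes inj_ea: "inj ea" and inj_ep: "inj ep"
begin

lemma inj_fm_code: "inj (fm_code ea ep)"
proof (rule injI)
  show "fm_code ea ep \<phi> = fm_code ea ep \<psi> \<Longrightarrow> \<phi> = \<psi>" for \<phi> \<psi>
  proof (induction \<phi> arbitrary: \<psi>)
    case Bot
    then show ?case by (cases \<psi>) auto
  next
    case (Atom p)
    then show ?case using inj_ep by (cases \<psi>) (auto dest: injD)
  next
    case (And \<phi>1 \<phi>2)
    then show ?case by (cases \<psi>) auto
  next
    case (Or \<phi>1 \<phi>2)
    then show ?case by (cases \<psi>) auto
  next
    case (Imp \<phi>1 \<phi>2)
    then show ?case by (cases \<psi>) auto
  next
    case (Know a \<phi>)
    then show ?case using inj_ea by (cases \<psi>) (auto dest: injD)
  next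
    case (Common \<phi>)
    then show ?case by (cases \<psi>) auto
  qed
qed

sublocale formula_labels "fm_code ea ep"
  "\<lambda>x y. prod_encode (2, prod_encode (x, y))" "\<lambda>x y. prod_encode (3, prod_encode (x, y))"
  "\<lambda>x y. prod_encode (4, prod_encode (x, y))" "\<lambda>a x. prod_encode (5, prod_encode (ea a, x))"
  "\<lambda>x. prod_encode (6, x)"
proof
  show "fm_code ea ep \<phi> = prod_encode (5, prod_encode (ea a, x)) \<longleftrightarrow>
      (\<exists>\<psi>. \<phi> = Know a \<psi> \<and> x = fm_code ea ep \<psi>)" for \<phi> a x
    using inj_ea by (cases \<phi>) (auto dest: injD)
  show "fm_code ea ep \<phi> = prod_encode (2, prod_encode (x, y)) \<longleftrightarrow>
      (\<exists>\<psi> \<chi>. \<phi> = And \<psi> \<chi> \<and> x = fm_code ea ep \<psi> \<and> y = fm_code ea ep \<chi>)" for \<phi> x y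
    by (cases \<phi>) auto
  show "fm_code ea ep \<phi> = prod_encode (3, prod_encode (x, y)) \<longleftrightarrow>
      (\<exists>\<psi> \<chi>. \<phi> = Or \<psi> \<chi> \<and> x = fm_code ea ep \<psi> \<and> y = fm_code ea ep \<chi>)" for \<phi> x y
    by (cases \<phi>) auto
  show "fm_code ea ep \<phi> = prod_encode (4, prod_encode (x, y)) \<longleftrightarrow>
      (\<exists>\<psi> \<chi>. \<phi> = Imp \<psi> \<chi> \<and> x = fm_code ea ep \<psi> \<and> y = fm_code ea ep \<chi>)" for \<phi> x y
    by (cases \<phi>) auto
  show "fm_code ea ep \<phi> = prod_encode (6, x) \<longleftrightarrow> (\<exists>\<psi>. \<phi> = Common \<psi> \<and> x = fm_code ea ep \<psi>)" for \<phi> x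
    by (cases \<phi>) auto
qed (rule inj_fm_code)

text \<open>Hence all labels of subformulae lie below \<open>Suc n\<close> for the input code
  \<open>n\<close>, which is where the exponents in the search bounds come from.\<close>

lemma fm_code_subformula: "\<psi> \<in> subformulae \<phi> \<Longrightarrow> fm_code ea ep \<psi> \<le> fm_code ea ep \<phi>"
proof (induction \<phi>)
  case (Common \<phi>)
  then show ?case by (auto intro: le_prod_encode_2 le_trans)
qed (auto intro: le_prod_encode_pair)

lemma computable_rel_type_acc:
  assumes "computable F" "computable G"
  shows "computable_rel (\<lambda>e. type_acc m a (set_decode (F e)) (set_decode (G e)))"
proof -
  have "computable_rel (\<lambda>e. type_acc m a (set_decode (e 0)) (set_decode (e (Suc 0))))"
  proof (cases m)
    case SysK
    show ?thesis unfolding SysK type_acc.simps all_know_bound[of 5] all_common_bound[of 6]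
      by (intro computable_intros)
  next
    case SysT
    show ?thesis unfolding SysT type_acc.simps all_know_bound[of 5] all_common_bound[of 6]
      by (intro computable_intros)
  next
    case SysS4
    show ?thesis unfolding SysS4 type_acc.simps all_know_bound[of 5] all_common_bound[of 6]
      by (intro computable_intros)
  next
    case SysS5
    \<comment> \<open>Each equivalence is split because its two directions are guarded by membership
      in different sets and so receive different bounds.\<close>
    show ?thesis unfolding SysS5 type_acc.simps iff_conv_conj_imp all_conj_distrib
        all_know_bound[of 5] all_common_bound[of 6]
      by (intro computable_intros)
  qed
  then show ?thesis
    using computable_apply2[where f = "\<lambda>s t. of_bool (type_acc m a (set_decode s) (set_decode t))"]
      assms by (simp add: computable_rel_def)
qed

lemma computable_rel_type_leq:
  assumes "computable F" "computable G"
  shows "computable_rel (\<lambda>e. type_leq m (set_decode (F e)) (set_decode (G e)))"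
proof -
  have "computable_rel (\<lambda>e. type_leq m (set_decode (e 0)) (set_decode (e (Suc 0))))"
    unfolding type_leq_def subset_eq by (intro computable_intros computable_rel_type_acc)
  then show ?thesis
    using computable_apply2[where f = "\<lambda>s t. of_bool (type_leq m (set_decode s) (set_decode t))"]
      assms by (simp add: computable_rel_def)
qed

text \<open>Injectivity of \<open>set_decode\<close> turns membership of a decoded type in a decoded
  family into membership of codes.\<close>

lemma computable_rel_common_condition:
  "computable_rel (\<lambda>e. common_condition m (set_decode ` set_decode (e 0)) (e (Suc 0)))"
  unfolding common_condition_def all_subset_set_decode ball_simps(9)
    inj_image_mem_iff[OF inj_set_decode]
  by (intro computable_intros computable_rel_type_acc)

lemma computable_rel_type_model:
  "computable_rel (\<lambda>e. type_model m (set_decode (e 0)) (set_decode ` set_decode (e (Suc 0))))"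
proof -
  have common: "computable_rel (\<lambda>e. common_condition m (set_decode ` set_decode (F e)) (G e))"
    if "computable F" "computable G" for F G
    using computable_apply2[where f = "\<lambda>h x. of_bool (common_condition m (set_decode ` set_decode h) x)"]
      computable_rel_common_condition that by (simp add: computable_rel_def)
  note rules = computable_intros computable_rel_type_acc computable_rel_type_leq common
  show ?thesis
    unfolding type_model_def ball_simps(9)
  proof (intro computable_rel_conj, goal_cases)
    case 1
    show ?case by (intro rules)
  next
    case 2
    show ?case unfolding all_pair_bound by (intro rules)
  next
    case 3
    show ?case unfolding all_pair_bound by (intro rules)
  next
    case 4
    show ?case unfolding all_pair_bound by (intro rules)
  next
    case 5
    show ?case unfolding all_know_bound by (intro rules)
  next
    case 6
    show ?case unfolding all_common_bound by (intro rules)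
  next
    case 7
    show ?case by (intro rules)
  qed
qed

text \<open>The bounds exceed the codes of all sets of labels up to \<open>n\<close>, and of all sets of such
  sets.\<close>

definition refutable :: "system \<Rightarrow> nat \<Rightarrow> bool" where
  "refutable m n \<longleftrightarrow> (\<exists>s<2 ^ Suc n. \<exists>h<2 ^ 2 ^ Suc n. n \<in> set_decode s \<and>
     (\<exists>t\<in>set_decode h. n \<notin> set_decode t) \<and>
     type_model m (set_decode s) (set_decode ` set_decode h))"

section \<open>The decision procedure and its correctness\<close>

lemma computable_rel_refutable: "computable_rel (\<lambda>e. refutable m (e 0))"
proof -
  have type_model: "computable_rel (\<lambda>e. type_model m (set_decode (F e)) (set_decode ` set_decode (G e)))"
    if "computable F" "computable G" for F G
    using computable_apply2[where f = "\<lambda>s h. of_bool (type_model m (set_decode s) (set_decode ` set_decode h))"]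
      computable_rel_type_model that by (simp add: computable_rel_def)
  show ?thesis unfolding refutable_def by (intro computable_intros type_model)
qed

text \<open>A successful search yields a finite set of types, and an infinite \<open>'w\<close> has
  room for a copy of it as worlds. Conversely, the types of any countermodel, with the true set of
  subformulae as guess, lie within the bounds.\<close>

lemma refutable_iff:
  assumes "infinite (UNIV :: 'w set)"
  shows "refutable m (fm_code ea ep \<phi>) \<longleftrightarrow> \<phi> \<notin> valid_formulae (frame_class m :: ('a, 'w) frame \<Rightarrow> bool)"
proof
  assume "refutable m (fm_code ea ep \<phi>)"
  then obtain s h t where sht: "fm_code ea ep \<phi> \<in> set_decode s" "t \<in> set_decode h"
    "fm_code ea ep \<phi> \<notin> set_decode t" "type_model m (set_decode s) (set_decode ` set_decode h)"
    by (auto simp: refutable_def)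
  obtain W :: "'w set" where "finite W" "card W = card (set_decode ` set_decode h)"
    using infinite_arbitrarily_large[OF assms] by blast
  then obtain th where th: "bij_betw th W (set_decode ` set_decode h)"
    by (metis finite_imageI finite_same_card_bij finite_set_decode)
  show "\<phi> \<notin> valid_formulae (frame_class m :: ('a, 'w) frame \<Rightarrow> bool)"
    using type_model_countermodel[OF sht(4) th sht(1) imageI[OF sht(2)] sht(3)]
    unfolding valid_formulae_def by blast
next
  let ?n = "fm_code ea ep \<phi>"
  let ?\<Sigma> = "fm_code ea ep ` subformulae \<phi>"
  assume "\<phi> \<notin> valid_formulae (frame_class m :: ('a, 'w) frame \<Rightarrow> bool)"
  from not_valid_type_model[OF this] obtain H T where
    H: "H \<subseteq> Pow ?\<Sigma>" "type_model m ?\<Sigma> H" and T: "T \<in> H" "?n \<notin> T"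
    by blast
  have fin: "finite ?\<Sigma>" by (simp add: finite_subformulae)
  then have finH: "finite H" and finT: "finite S" if "S \<in> H" for S
    using H(1) that by (meson finite_Pow_iff finite_subset, meson PowD finite_subset subsetD)
  have \<Sigma>: "?\<Sigma> \<subseteq> {..<Suc ?n}" using fm_code_subformula by (auto simp: less_Suc_eq_le)
  have "set_encode ` H \<subseteq> {..<2 ^ Suc ?n}"
  proof
    fix t assume "t \<in> set_encode ` H"
    then obtain S where "t = set_encode S" "S \<in> H" by blast
    then show "t \<in> {..<2 ^ Suc ?n}"
      using set_encode_less[of S "Suc ?n"] H(1) \<Sigma> by blast
  qed
  then have h: "set_encode (set_encode ` H) < 2 ^ 2 ^ Suc ?n"
    by (rule set_encode_less)
  have dec: "set_decode (set_encode (set_encode ` H)) = set_encode ` H"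
    using finH T(1) by simp
  have decH: "set_decode ` set_encode ` H = H"
    using finT by (simp add: image_image)
  show "refutable m ?n"
    unfolding refutable_def
  proof (intro exI conjI)
    show "set_encode ?\<Sigma> < 2 ^ Suc ?n" by (rule set_encode_less[OF \<Sigma>])
    show "set_encode (set_encode ` H) < 2 ^ 2 ^ Suc ?n" by (rule h)
    show "?n \<in> set_decode (set_encode ?\<Sigma>)"
      using fin imageI[OF subformulae_self, of "fm_code ea ep" \<phi>] by simp
    show "\<exists>t\<in>set_decode (set_encode (set_encode ` H)). ?n \<notin> set_decode t"
      unfolding dec using T finT by auto
    show "type_model m (set_decode (set_encode ?\<Sigma>))
        (set_decode ` set_decode (set_encode (set_encode ` H)))"
      unfolding dec decH using H(2) fin by simp
  qed
qed

lemma decidable_valid_formulae: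
  assumes "infinite (UNIV :: 'w set)"
  shows "decidable (fm_code ea ep) (valid_formulae (frame_class m :: ('a, 'w) frame \<Rightarrow> bool))"
proof -
  have "computable (\<lambda>e. of_bool (\<not> refutable m (e 0)))"
    using computable_rel_not[OF computable_rel_refutable] by (simp only: computable_rel_def)
  then obtain g where g: "recursive 1 g" "\<And>c. g [c] = of_bool (\<not> refutable m c)"
    using computable_unary[of "\<lambda>n. of_bool (\<not> refutable m n)"] by blast
  show ?thesis
    unfolding decidable_def using g refutable_iff[OF assms] by auto
qed

end

theorem mainTheorem9:
  shows
    "finite_model_property (ICK TYPE('w) :: ('a::finite, 'p) fm set)
       (epistemic_frame :: ('a, nat) frame \<Rightarrow> bool) \<and>
     finite_model_property (ICKT TYPE('w) :: ('a, 'p) fm set)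
       (reflexive_frame :: ('a, nat) frame \<Rightarrow> bool) \<and>
     finite_model_property (ICKS4 TYPE('w) :: ('a, 'p) fm set)
       (S4_frame :: ('a, nat) frame \<Rightarrow> bool) \<and>
     finite_model_property (ICKS5 TYPE('w) :: ('a, 'p) fm set)
       (S5_frame :: ('a, nat) frame \<Rightarrow> bool) \<and>
     (infinite (UNIV :: 'w set) \<longrightarrow>
       (\<forall>(ea :: 'a \<Rightarrow> nat) (ep :: 'p \<Rightarrow> nat). inj ea \<longrightarrow> inj ep \<longrightarrow>
          decidable (fm_code ea ep) (ICK TYPE('w) :: ('a, 'p) fm set) \<and>
          decidable (fm_code ea ep) (ICKT TYPE('w) :: ('a, 'p) fm set) \<and>
          decidable (fm_code ea ep) (ICKS4 TYPE('w) :: ('a, 'p) fm set) \<and>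
          decidable (fm_code ea ep) (ICKS5 TYPE('w) :: ('a, 'p) fm set)))"
proof -
  have logics: "ICK TYPE('w) = valid_formulae (frame_class SysK :: ('a, 'w) frame \<Rightarrow> bool)"
    "ICKT TYPE('w) = valid_formulae (frame_class SysT :: ('a, 'w) frame \<Rightarrow> bool)"
    "ICKS4 TYPE('w) = valid_formulae (frame_class SysS4 :: ('a, 'w) frame \<Rightarrow> bool)"
    "ICKS5 TYPE('w) = valid_formulae (frame_class SysS5 :: ('a, 'w) frame \<Rightarrow> bool)"
    by (simp_all add: ICK_def ICKT_def ICKS4_def ICKS5_def)
  have dec: "decidable (fm_code ea ep)
      (valid_formulae (frame_class m :: ('a, 'w) frame \<Rightarrow> bool) :: ('a, 'p) fm set)"
    if "infinite (UNIV :: 'w set)" "inj ea" "inj ep" for m and ea :: "'a \<Rightarrow> nat" and ep :: "'p \<Rightarrow> nat"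
  proof -
    interpret goedel_numbering ea ep by unfold_locales (rule that)+
    show ?thesis by (rule decidable_valid_formulae[OF that(1)])
  qed
  show ?thesis
    unfolding logics frame_class.simps[symmetric]
    by (intro conjI impI allI dec finite_model_property_frame_class)
qed

end
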